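(* Let $K$ be a real quadratic field with ring of integers $R$, let $\alpha\in R$ be a unit with $\alpha\neq\pm1$ and $\alpha>0$, and let $\Delta=(\Delta_n)_{n\geqslant 1}$ with $\Delta_n=N_{K/\mathbb{Q}}(\alpha^n-1)$ be the Lehmer-Pierce sequence associated to $\alpha$. (i) If $N_{K/\mathbb{Q}}(\alpha)=1$, then $\Delta_n$ has a primitive prime divisor for every $n>12$. (ii) If $N_{K/\mathbb{Q}}(\alpha)=-1$, then for every $n>24$, $\Delta_n$ fails to have a primitive prime divisor if and only if $n\equiv 2\pmod 4$.
   Context: For an integer sequence $(a_n)_{n\geqslant1}$, a prime $p$ dividing $a_n$ is called a primitive prime divisor of $a_n$ if $p$ does not divide $a_m$ for any $m<n$ with $a_m\neq0$. $N_{K/\mathbb{Q}}$ denotes the field norm. $K$ is regarded as a subfield of $\mathbb{R}$. *)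

theory Defs
  imports
    "HOL-Computational_Algebra.Computational_Algebra"
    "HOL-Number_Theory.Cong"
    "Jordan_Normal_Form.Determinant"
begin

global_interpretation over_rat: vector_space "\<lambda>(q::rat) (x::real). of_rat q * x"
  by unfold_locales (auto simp: algebra_simps of_rat_add of_rat_mult)

definition real_subfield :: "real set \<Rightarrow> bool" where
  "real_subfield K \<longleftrightarrow>
     0 \<in> K \<and> 1 \<in> K \<and>
     (\<forall>x\<in>K. \<forall>y\<in>K. x + y \<in> K \<and> x * y \<in> K) \<and>
     (\<forall>x\<in>K. - x \<in> K \<and> inverse x \<in> K)"

definition real_quadratic_field :: "real set \<Rightarrow> bool" where
  "real_quadratic_field K \<longleftrightarrow> real_subfield K \<and> over_rat.dim K = 2"

definition ring_of_integers :: "real set \<Rightarrow> real set" where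
  "ring_of_integers K = {x \<in> K. algebraic_int x}"

definition rat_basis :: "real set \<Rightarrow> real list \<Rightarrow> bool" where
  "rat_basis K bs \<longleftrightarrow>
     distinct bs \<and> over_rat.independent (set bs) \<and> over_rat.span (set bs) = K"

text \<open>Column \<open>j\<close> holds the coordinates of \<open>x * bs ! j\<close> in the basis \<open>bs\<close>.\<close>

definition mult_matrix :: "real list \<Rightarrow> real \<Rightarrow> rat mat" where
  "mult_matrix bs x = mat (length bs) (length bs)
     (\<lambda>(i, j). over_rat.representation (set bs) (x * bs ! j) (bs ! i))"

text \<open>The norm of \<open>x\<close> from \<open>K\<close> to the rationals is the determinant of multiplication by \<open>x\<close> on the
  rational vector space \<open>K\<close>; it does not depend on the basis.\<close>

definition field_norm :: "real set \<Rightarrow> real \<Rightarrow> rat" where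
  "field_norm K x = det (mult_matrix (SOME bs. rat_basis K bs) x)"

text \<open>The norm of an algebraic integer is an integer, so for \<open>\<alpha>\<close> in the ring of integers the
  description below is satisfied (lemma \<open>of_int_lehmer_pierce\<close>).\<close>

definition lehmer_pierce :: "real set \<Rightarrow> real \<Rightarrow> nat \<Rightarrow> int" where
  "lehmer_pierce K \<alpha> n = (THE z. of_int z = field_norm K (\<alpha> ^ n - 1))"

lemma real_quadratic_field_span:
  assumes "real_quadratic_field K"
  shows "over_rat.span K = K"
proof -
  have of_nat: "of_nat n \<in> K" for n
    using assms by (induction n) (auto simp: real_quadratic_field_def real_subfield_def)
  have of_int: "of_int z \<in> K" for z
    using assms of_nat by (cases z rule: int_cases2)
      (auto simp: real_quadratic_field_def real_subfield_def)
  have "of_rat q \<in> K" for q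
  proof -
    obtain a b where "q = of_int a / of_int b"
      by (metis Fract_of_int_quotient Rat_cases)
    then have "of_rat q = of_int a * inverse (of_int b :: real)"
      by (simp add: of_rat_divide field_simps)
    then show ?thesis
      using assms of_int by (auto simp: real_quadratic_field_def real_subfield_def)
  qed
  then have "over_rat.subspace K"
    using assms by (auto simp: over_rat.subspace_def real_quadratic_field_def real_subfield_def)
  then show ?thesis
    by (simp add: over_rat.span_eq_iff)
qed

lemma rat_basis_exists:
  assumes "real_quadratic_field K"
  obtains a b where "(SOME bs. rat_basis K bs) = [a, b]" "rat_basis K [a, b]"
proof -
  obtain B where B: "B \<subseteq> K" "over_rat.independent B" "K \<subseteq> over_rat.span B"
      "card B = over_rat.dim K"
    using over_rat.basis_exists by blast
  have card: "card B = 2"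
    using assms B by (simp add: real_quadratic_field_def)
  then have "finite B" by (simp add: card_ge_0_finite)
  then obtain bs0 where bs0: "set bs0 = B" "distinct bs0"
    using finite_distinct_list by blast
  have "over_rat.span B = K"
    using B over_rat.span_mono[OF B(1)] real_quadratic_field_span[OF assms] by auto
  then have "rat_basis K bs0"
    using B bs0 by (auto simp: rat_basis_def)
  then have bs: "rat_basis K (SOME bs. rat_basis K bs)" (is "rat_basis K ?bs")
    by (rule someI)
  have "over_rat.dim K = card (set ?bs)"
    using bs over_rat.dim_span_eq_card_independent[of "set ?bs"]
    unfolding rat_basis_def by metis
  then have "length ?bs = 2"
    using bs assms by (simp add: rat_basis_def distinct_card real_quadratic_field_def)
  then obtain a b where "?bs = [a, b]"
    by (auto simp: numeral_2_eq_2 length_Suc_conv)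
  then show ?thesis using bs that by metis
qed

lemma field_norm_of_rat:
  assumes "real_quadratic_field K"
  shows "field_norm K (of_rat q) = q\<^sup>2"
proof -
  obtain a b where ab: "(SOME bs. rat_basis K bs) = [a, b]" "rat_basis K [a, b]"
    using rat_basis_exists[OF assms] .
  have ind: "over_rat.independent {a, b}" and ne: "a \<noteq> b"
    using ab by (auto simp: rat_basis_def)
  have rep: "over_rat.representation {a, b} (of_rat q * c) d = (if d = c then q else 0)"
    if "c \<in> {a, b}" for c d
    using over_rat.representation_scale[OF ind over_rat.span_base[OF that], of q]
      over_rat.representation_basis[OF ind that] by simp
  have "mult_matrix [a, b] (of_rat q) = q \<cdot>\<^sub>m 1\<^sub>m 2"
    using ne rep by (auto simp: mult_matrix_def less_2_cases_iff intro!: eq_matI)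
  then show ?thesis
    by (simp add: field_norm_def ab)
qed

lemma field_norm_quadratic:
  assumes "real_quadratic_field K" "x \<in> K"
  obtains t where "x\<^sup>2 - of_rat t * x + of_rat (field_norm K x) = 0"
proof -
  obtain a b where ab: "(SOME bs. rat_basis K bs) = [a, b]" "rat_basis K [a, b]"
    using rat_basis_exists[OF assms(1)] .
  have ind: "over_rat.independent {a, b}" and ne: "a \<noteq> b" and span: "over_rat.span {a, b} = K"
    using ab by (auto simp: rat_basis_def)
  have abK: "a \<in> K" "b \<in> K"
    using over_rat.span_base[of _ "{a, b}"] span by auto
  have a0: "a \<noteq> 0"
    using ind over_rat.dependent_zero by blast
  define M where "M i j = over_rat.representation {a, b} (x * [a, b] ! j) ([a, b] ! i)" for i j
  have eq: "x * c = of_rat (over_rat.representation {a, b} (x * c) a) * a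
      + of_rat (over_rat.representation {a, b} (x * c) b) * b" if "c \<in> {a, b}" for c
  proof -
    have "x * c \<in> over_rat.span {a, b}"
      using span abK that assms by (auto simp: real_quadratic_field_def real_subfield_def)
    from over_rat.sum_representation_eq[OF ind this, of "{a, b}"] show ?thesis
      using ne by simp
  qed
  have xa: "x * a = of_rat (M 0 0) * a + of_rat (M 1 0) * b"
    and xb: "x * b = of_rat (M 0 1) * a + of_rat (M 1 1) * b"
    using eq[of a] eq[of b] by (simp_all add: M_def)
  have mat: "mult_matrix [a, b] x = mat 2 2 (\<lambda>(i, j). M i j)"
    by (auto simp: mult_matrix_def M_def numeral_2_eq_2 intro!: eq_matI)
  have "det (mat 2 2 (\<lambda>(i, j). M i j)) = M 0 0 * M 1 1 - M 0 1 * M 1 0"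
  proof -
    have "det (mat 2 2 (\<lambda>(i, j). M i j)) =
        (\<Sum>i<2. mat 2 2 (\<lambda>(i, j). M i j) $$ (i, 0) * cofactor (mat 2 2 (\<lambda>(i, j). M i j)) i 0)"
      by (rule laplace_expansion_column) auto
    then show ?thesis
      by (simp add: numeral_2_eq_2 cofactor_def mat_delete_def det_single)
  qed
  then have N: "field_norm K x = M 0 0 * M 1 1 - M 0 1 * M 1 0"
    by (simp add: field_norm_def ab mat)
  have "(x - of_rat (M 1 1)) * (x * a - of_rat (M 0 0) * a)
      = of_rat (M 1 0) * (x * b - of_rat (M 1 1) * b)"
    using xa by (simp add: algebra_simps)
  also have "\<dots> = of_rat (M 1 0) * of_rat (M 0 1) * a"
    using xb by (simp add: algebra_simps)
  finally have "a * (x\<^sup>2 - of_rat (M 0 0 + M 1 1) * x + of_rat (field_norm K x)) = 0"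
    by (simp add: N of_rat_add of_rat_mult of_rat_diff power2_eq_square algebra_simps)
  then show ?thesis
    using that a0 by auto
qed

lemma rat_quadratic_unique:
  fixes x :: real
  assumes "x \<notin> \<rat>" "x\<^sup>2 - of_rat t * x + of_rat d = 0" "x\<^sup>2 - of_rat t' * x + of_rat d' = 0"
  shows "t = t'" "d = d'"
proof -
  have *: "of_rat (t - t') * x = of_rat (d - d')"
    using assms(2,3) by (simp add: of_rat_diff algebra_simps)
  show "t = t'"
  proof (rule ccontr)
    assume "t \<noteq> t'"
    then have "x = of_rat ((d - d') / (t - t'))"
      using * by (simp add: of_rat_divide field_simps)
    with assms(1) show False by (metis Rats_of_rat)
  qed
  with * show "d = d'" by simp
qed

lemma algebraic_int_quadratic:
  fixes x :: real
  assumes "algebraic_int x" "x \<notin> \<rat>" "x\<^sup>2 - of_rat t * x + of_rat d = 0"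
  shows "t \<in> \<int>" "d \<in> \<int>"
proof -
  obtain p :: "int poly" where p: "poly (map_poly of_int p) x = 0" "lead_coeff p = 1"
    using assms(1) by (auto simp: algebraic_int_altdef_ipoly)
  obtain t1 t2 where t: "t = of_int t1 / of_int t2" "t2 \<noteq> 0"
    by (metis Fract_of_int_quotient Rat_cases less_irrefl)
  obtain d1 d2 where d: "d = of_int d1 / of_int d2" "d2 \<noteq> 0"
    by (metis Fract_of_int_quotient Rat_cases less_irrefl)
  define q0 where "q0 = [:d1 * t2, - (t1 * d2), t2 * d2:]"
  have q0: "q0 \<noteq> 0" using t d by (simp add: q0_def)
  define q where "q = primitive_part q0"
  have q0q: "q0 = Polynomial.smult (content q0) q" by (simp add: q_def)
  have c0: "content q0 \<noteq> 0" using q0 by simp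
  have qnz: "q \<noteq> 0" and qc: "content q = 1" using q0 by (auto simp: q_def)
  have deg: "degree q = 2" using t d by (simp add: q_def q0_def)
  have [simp]: "map_poly (of_int :: int \<Rightarrow> real) (f * g) = map_poly of_int f * map_poly of_int g"
    and [simp]: "map_poly (of_int :: int \<Rightarrow> real) (f + g) = map_poly of_int f + map_poly of_int g"
    and [simp]: "map_poly (of_int :: int \<Rightarrow> real) (Polynomial.smult c g) = Polynomial.smult (of_int c) (map_poly of_int g)"
    for f g c
    by (auto intro!: poly_eqI simp: coeff_map_poly coeff_mult)
  have "poly (map_poly of_int q0) x = of_int (t2 * d2) * (x\<^sup>2 - of_rat t * x + of_rat d)"
  proof -
    have "of_rat t = (of_int t1 / of_int t2 :: real)" "of_rat d = (of_int d1 / of_int d2 :: real)"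
      by (simp_all add: t d of_rat_divide)
    then show ?thesis
      using t(2) d(2) by (simp add: q0_def map_poly_pCons field_simps power2_eq_square)
  qed
  then have "poly (map_poly of_int q0) x = 0" using assms(3) by simp
  then have qx: "poly (map_poly of_int q) x = 0"
    using c0 by (subst (asm) q0q) (simp del: content_times_primitive_part)
  obtain e s where es: "e \<noteq> 0" "Polynomial.smult e p = q * s + pseudo_mod p q"
    using pseudo_mod(1)[OF qnz] by blast
  define r where "r = pseudo_mod p q"
  have "degree r < 2"
    using pseudo_mod(2)[OF qnz, of p] deg by (auto simp: r_def)
  then have "r = [:coeff r 0, coeff r 1:]"
    by (auto intro!: poly_eqI simp: coeff_pCons coeff_eq_0 split: nat.splits)
  then obtain r0 r1 where r: "r = [:r0, r1:]" by blast
  have "map_poly (of_int :: int \<Rightarrow> real) (Polynomial.smult e p) = map_poly of_int (q * s + r)"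
    using es by (simp only: r_def)
  from arg_cong[OF this, of "\<lambda>f. poly f x"] have "poly (map_poly of_int r) x = 0"
    using p qx by simp
  then have rx: "of_int r0 + of_int r1 * x = 0"
    by (simp add: r map_poly_pCons mult.commute)
  have "r1 = 0"
  proof (rule ccontr)
    assume "r1 \<noteq> 0"
    then have "x = - of_int r0 / of_int r1" using rx by (simp add: field_simps)
    with assms(2) show False by simp
  qed
  with rx r have "r = 0" by simp
  with es have pqs: "Polynomial.smult e p = q * s" by (simp add: r_def)
  have "content p dvd 1"
    using content_dvd_coeff[of p "degree p"] p by simp
  then have "content p = 1" by (metis content_1 is_unit_content_iff dvd_refl content_eq_zero_iff is_unit_normalize normalize_content)
  with pqs have "\<bar>e\<bar> = content s"
    by (metis content_mult content_smult mult.left_neutral mult.right_neutral normalize_int_def qc)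
  then have "Polynomial.smult e p = Polynomial.smult \<bar>e\<bar> (q * primitive_part s)"
    using pqs by (metis content_times_primitive_part mult_smult_right)
  from arg_cong[OF this, of lead_coeff]
  have "e * lead_coeff p = \<bar>e\<bar> * (lead_coeff q * lead_coeff (primitive_part s))"
    by (simp only: lead_coeff_smult lead_coeff_mult)
  then have "\<bar>e\<bar> * \<bar>lead_coeff q * lead_coeff (primitive_part s)\<bar> = \<bar>e\<bar> * 1"
    unfolding p(2) by (metis abs_mult abs_abs mult.right_neutral)
  then have "\<bar>lead_coeff q * lead_coeff (primitive_part s)\<bar> = 1"
    using es(1) by (metis abs_eq_0_iff mult_left_cancel)
  then have "lead_coeff q dvd 1"
    by (metis abs_dvd_iff dvd_abs_iff dvd_triv_left)
  then obtain u where u: "u * coeff q 2 = 1" using deg by (metis dvdE mult.commute)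
  have u': "of_int u * (of_int (coeff q 2) :: real) = 1" using u by (metis of_int_1 of_int_mult)
  have "q = [:coeff q 0, coeff q 1, coeff q 2:]"
    using deg by (auto intro!: poly_eqI simp: coeff_pCons numeral_2_eq_2 coeff_eq_0 split: nat.splits)
  then have "map_poly of_int q = [:of_int (coeff q 0), of_int (coeff q 1), of_int (coeff q 2 :: int) :: real:]"
    by (metis map_poly_pCons of_int_0 map_poly_0)
  with qx have "of_int (coeff q 2) * x\<^sup>2 + of_int (coeff q 1) * x + of_int (coeff q 0) = 0"
    by (simp add: power2_eq_square algebra_simps)
  then have "of_int u * (of_int (coeff q 2) * x\<^sup>2 + of_int (coeff q 1) * x + of_int (coeff q 0)) = 0"
    by simp
  then have "(of_int u * of_int (coeff q 2)) * x\<^sup>2 + of_int (u * coeff q 1) * x + of_int (u * coeff q 0) = 0"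
    by (simp add: algebra_simps)
  then have "x\<^sup>2 - of_rat (of_int (- u * coeff q 1)) * x + of_rat (of_int (u * coeff q 0)) = 0"
    unfolding of_rat_of_int_eq u' by simp
  from rat_quadratic_unique[OF assms(2,3) this] show "t \<in> \<int>" "d \<in> \<int>" by auto
qed

lemma of_int_lehmer_pierce:
  assumes K: "real_quadratic_field K" and "\<alpha> \<in> ring_of_integers K"
  shows "of_int (lehmer_pierce K \<alpha> n) = field_norm K (\<alpha> ^ n - 1)"
proof -
  have \<alpha>: "\<alpha> \<in> K" "algebraic_int \<alpha>"
    using assms by (auto simp: ring_of_integers_def)
  have of_int: "field_norm K (of_int z) \<in> \<int>" for z
    using field_norm_of_rat[OF K, of "of_int z"] by simp
  have "field_norm K (\<alpha> ^ n - 1) \<in> \<int>"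
  proof (cases "\<alpha> \<in> \<rat>")
    case True
    then obtain k where "\<alpha> = of_int k"
      using \<alpha> rational_algebraic_int_is_int by (metis Ints_cases)
    then show ?thesis using of_int[of "k ^ n - 1"] by simp
  next
    case False
    obtain t where "\<alpha>\<^sup>2 - of_rat t * \<alpha> + of_rat (field_norm K \<alpha>) = 0"
      using field_norm_quadratic[OF K \<alpha>(1)] .
    with algebraic_int_quadratic[OF \<alpha>(2) False this]
    obtain a b :: int where "\<alpha>\<^sup>2 - of_int a * \<alpha> + of_int b = 0"
      by (auto elim!: Ints_cases)
    then have sq: "\<alpha>\<^sup>2 = of_int a * \<alpha> - of_int b" by simp
    have "\<exists>u v :: int. \<alpha> ^ n = of_int u + of_int v * \<alpha>"
    proof (induction n)
      case 0
      show ?case by (intro exI[of _ 1] exI[of _ 0]) simp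
    next
      case (Suc n)
      then obtain u v :: int where "\<alpha> ^ n = of_int u + of_int v * \<alpha>" by blast
      then have "\<alpha> ^ Suc n = of_int u * \<alpha> + of_int v * \<alpha>\<^sup>2"
        by (simp add: algebra_simps power2_eq_square)
      also have "\<dots> = of_int (- (v * b)) + of_int (u + v * a) * \<alpha>"
        by (simp add: sq algebra_simps)
      finally show ?case by blast
    qed
    then obtain u' v :: int where "\<alpha> ^ n = of_int u' + of_int v * \<alpha>" by blast
    then obtain u where y: "\<alpha> ^ n - 1 = of_int u + of_int v * \<alpha>"
      by (metis add_diff_eq add.commute of_int_1 of_int_diff diff_add_eq)
    show ?thesis
    proof (cases "v = 0")
      case True
      then show ?thesis using y of_int[of u] by simp
    next
      case v: False
      define y where "y = \<alpha> ^ n - 1"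
      have ya: "y = of_int u + of_int v * \<alpha>" using y by (simp add: y_def)
      have irr: "y \<notin> \<rat>"
      proof
        assume "y \<in> \<rat>"
        moreover have "\<alpha> = (y - of_int u) / of_int v" using v ya by (simp add: field_simps)
        ultimately show False using False by simp
      qed
      have "\<alpha> ^ n \<in> K"
        using K \<alpha>(1) by (induction n) (auto simp: real_quadratic_field_def real_subfield_def)
      then have "\<alpha> ^ n + - 1 \<in> K"
        using K unfolding real_quadratic_field_def real_subfield_def by blast
      then have "y \<in> K" by (simp add: y_def)
      then obtain s where s: "y\<^sup>2 - of_rat s * y + of_rat (field_norm K y) = 0"
        using field_norm_quadratic[OF K] by blast
      have "y\<^sup>2 - of_int (2 * u + v * a) * y + of_int (u\<^sup>2 + u * v * a + v\<^sup>2 * b)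
          = of_int (v\<^sup>2) * (\<alpha>\<^sup>2 - (of_int a * \<alpha> - of_int b))"
        by (simp add: ya algebra_simps power2_eq_square)
      then have yq: "y\<^sup>2 - of_rat (of_int (2 * u + v * a)) * y
          + of_rat (of_int (u\<^sup>2 + u * v * a + v\<^sup>2 * b)) = 0"
        unfolding of_rat_of_int_eq using sq by simp
      from rat_quadratic_unique(2)[OF irr s yq] show ?thesis
        unfolding y_def by (metis Ints_of_int)
    qed
  qed
  then obtain z where z: "field_norm K (\<alpha> ^ n - 1) = of_int z"
    by (elim Ints_cases)
  then show ?thesis
    unfolding lehmer_pierce_def by (simp add: z)
qed

text \<open>Sequences are indexed from 1; the value at 0 is ignored.\<close>

definition primitive_prime_divisor :: "(nat \<Rightarrow> int) \<Rightarrow> nat \<Rightarrow> nat \<Rightarrow> bool" where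
  "primitive_prime_divisor a n p \<longleftrightarrow>
     prime p \<and> int p dvd a n \<and>
     (\<forall>m. 1 \<le> m \<and> m < n \<and> a m \<noteq> 0 \<longrightarrow> \<not> int p dvd a m)"

end

theory Submission
  imports Defs "HOL-Number_Theory.Number_Theory"
begin

text \<open>
  Let \<open>g > 1\<close> be a unit of norm 1 and trace \<open>t\<close>, and put \<open>W n = g ^ n + g ^ (-n) - 2\<close>, so that the
  Lehmer-Pierce sequence of \<open>g\<close> is \<open>- W n\<close>. The alternating sum of \<open>ln (W (n div \<Prod>S))\<close> over the sets
  \<open>S\<close> of primes dividing \<open>n\<close> is the logarithm of the norm of the \<open>n\<close>-th cyclotomic polynomial at \<open>g\<close>.
  Size: it exceeds \<open>totient n * ln g + 2 * ln 0.44\<close>, hence \<open>2 * ln (totient n + 1)\<close> when \<open>n > 12\<close>.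
  Divisibility: a prime \<open>p\<close> with rank of apparition \<open>r\<close> has nonzero exponent in this norm only if
  \<open>n = r * p ^ j\<close>, and for \<open>j > 0\<close> and \<open>n > 12\<close> the exponent is 2. As \<open>r \<le> p + 1\<close>, at most one prime
  occurs with \<open>j > 0\<close>, and it divides \<open>n\<close>; so without a primitive prime divisor (\<open>j = 0\<close>) the
  logarithm is at most \<open>2 * ln (totient n + 1)\<close>.

  For a unit \<open>\<alpha>\<close> of norm \<open>-1\<close> take \<open>g = \<alpha>\<^sup>2\<close>: then \<open>\<Delta> (2 * m) = - W m\<close>, and \<open>(\<Delta> m)\<^sup>2 = W m\<close> for odd
  \<open>m\<close>. In particular \<open>\<Delta> (2 * m) = - (\<Delta> m)\<^sup>2\<close> for odd \<open>m\<close>, which is the exceptional case.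
\<close>

section \<open>Traces of powers of a unit\<close>

text \<open>Dickson polynomials of the first kind with parameter 1, evaluated at \<open>t\<close>.
  Here \<open>W n\<close> is \<open>dickson t n - 2\<close>: divisibility is treated in the
  integers, and the real root \<open>g\<close> serves only for identities and size bounds.\<close>

fun dickson :: "int \<Rightarrow> nat \<Rightarrow> int" where
  "dickson t 0 = 2"
| "dickson t (Suc 0) = t"
| "dickson t (Suc (Suc n)) = t * dickson t (Suc n) - dickson t n"

lemma dickson_2: "dickson t 2 = t\<^sup>2 - 2"
  by (simp add: numeral_2_eq_2)

lemma dickson_3: "dickson t 3 = t ^ 3 - 3 * t"
  by (simp add: eval_nat_numeral algebra_simps)

lemma of_int_dickson:
  fixes g :: real
  assumes "g \<noteq> 0" "of_int t = g + 1 / g"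
  shows "of_int (dickson t n) = g ^ n + (1 / g) ^ n"
proof (induction n rule: induct_nat_012)
  case (ge2 n)
  then have "of_int (dickson t (Suc (Suc n)))
      = (g + 1 / g) * (g ^ Suc n + (1 / g) ^ Suc n) - (g ^ n + (1 / g) ^ n)"
    unfolding dickson.simps of_int_diff of_int_mult using assms(2) by metis
  also have "\<dots> = g ^ Suc (Suc n) + (1 / g) ^ Suc (Suc n)"
    using assms(1) by (simp add: field_simps)
  finally show ?case .
qed (use assms in auto)

text \<open>\<open>g\<close> is the larger root of \<open>x^2 - t * x + 1\<close>. The bound 2.6
  lies just below \<open>(3 + sqrt 5) / 2\<close>, the root at the smallest admissible
  \<open>t = 3\<close>.\<close>

lemma dickson_root:
  assumes "t \<ge> 3"
  obtains g :: real where "g \<ge> 2.6" "of_int t = g + 1 / g"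
proof -
  define s where "s = sqrt ((of_int t)\<^sup>2 - 4 :: real)"
  have t: "real_of_int t \<ge> 3" using assms by simp
  then have t2: "(real_of_int t)\<^sup>2 \<ge> 9"
    using power_mono[of 3 "real_of_int t" 2] by simp
  then have s2: "s\<^sup>2 = (of_int t)\<^sup>2 - 4" by (simp add: s_def)
  have s: "s \<ge> 2.2"
    unfolding s_def by (rule real_le_rsqrt) (use t2 in \<open>simp add: power2_eq_square\<close>)
  define g where "g = (of_int t + s) / 2"
  have g: "g \<ge> 2.6" using t s by (simp add: g_def)
  have "g * g + 1 = of_int t * g"
    using s2 by (simp add: g_def field_simps power2_eq_square)
  then have "of_int t = g + 1 / g" using g by (simp add: field_simps)
  with g that show ?thesis by blast
qed

lemma dickson_ge:
  assumes "t \<ge> 3"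
  shows "dickson t n \<ge> 2 \<and> dickson t (Suc n) \<ge> dickson t n + 1"
proof (induction n)
  case (Suc n)
  then have "t * dickson t (Suc n) \<ge> 3 * dickson t (Suc n)"
    using assms by (intro mult_right_mono) auto
  with Suc show ?case unfolding dickson.simps by linarith
qed (use assms in simp)

lemma dickson_ge_3:
  assumes "t \<ge> 3" "n > 0"
  shows "dickson t n \<ge> 3"
  using dickson_ge[OF assms(1), of "n - 1"] assms(2) by simp

text \<open>Passing from \<open>g\<close> to \<open>g ^ m\<close> replaces the trace
  \<open>t\<close> by \<open>dickson t m\<close>, so questions about the index \<open>m * k\<close>
  reduce to the index \<open>k\<close> with another trace.\<close>

lemma dickson_mult:
  assumes "t \<ge> 3"
  shows "dickson (dickson t m) k = dickson t (m * k)"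
proof -
  obtain g :: real where g: "g \<ge> 2.6" "of_int t = g + 1 / g"
    using dickson_root[OF assms] .
  have "g ^ m \<noteq> 0" and m: "of_int (dickson t m) = g ^ m + 1 / g ^ m"
    using g of_int_dickson[of g t m] by (auto simp: power_one_over)
  then have "real_of_int (dickson (dickson t m) k) = (g ^ m) ^ k + (1 / g ^ m) ^ k"
    using of_int_dickson by blast
  also have "\<dots> = real_of_int (dickson t (m * k))"
    using g of_int_dickson[of g t "m * k"] by (simp add: power_mult power_one_over)
  finally show ?thesis by linarith
qed

lemma dickson_add_diff:
  assumes "t \<ge> 3" "j \<le> i"
  shows "dickson t (i + j) + dickson t (i - j) = dickson t i * dickson t j"
    and "dickson t (i + j) * dickson t (i - j) = (dickson t i)\<^sup>2 + (dickson t j)\<^sup>2 - 4"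
proof -
  obtain g :: real where g: "g \<ge> 2.6" "of_int t = g + 1 / g"
    using dickson_root[OF assms(1)] .
  obtain k where k: "i = j + k" using assms(2) le_Suc_ex by blast
  define a b a' b' where "a = g ^ j" and "b = g ^ k" and "a' = (1 / g) ^ j" and "b' = (1 / g) ^ k"
  have ab: "a * a' = 1" "b * b' = 1"
    using g by (auto simp: a_def b_def a'_def b'_def power_mult_distrib[symmetric])
  have *: "real_of_int (dickson t i) = a * b + a' * b'"
     "real_of_int (dickson t j) = a + a'"
     "real_of_int (dickson t (i - j)) = b + b'"
     "real_of_int (dickson t (i + j)) = a * a * b + a' * a' * b'"
    using g of_int_dickson[of g t]
    by (auto simp: k a_def b_def a'_def b'_def power_add)
  have "real_of_int (dickson t (i + j) + dickson t (i - j)) = of_int (dickson t i * dickson t j)"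
  proof -
    have "(a * b + a' * b') * (a + a') = a * a * b + a' * a' * b' + (a * a') * b + (a * a') * b'"
      by (simp add: algebra_simps)
    then show ?thesis unfolding of_int_add of_int_mult * ab by simp
  qed
  then show "dickson t (i + j) + dickson t (i - j) = dickson t i * dickson t j"
    by linarith
  have "real_of_int (dickson t (i + j) * dickson t (i - j)) =
      of_int ((dickson t i)\<^sup>2 + (dickson t j)\<^sup>2 - 4)"
  proof -
    have "(a * a * b + a' * a' * b') * (b + b')
        = a * a * b * b + a' * a' * b' * b' + a * a * (b * b') + a' * a' * (b * b')"
      by (simp add: algebra_simps)
    moreover have "(a * b + a' * b')\<^sup>2 + (a + a')\<^sup>2 - 4
        = a * a * b * b + a' * a' * b' * b' + 2 * ((a * a') * (b * b')) + a * a + 2 * (a * a') + a' * a' - 4"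
      by (simp add: power2_eq_square algebra_simps)
    ultimately show ?thesis
      unfolding of_int_add of_int_diff of_int_power of_int_mult of_int_numeral * ab by simp
  qed
  then show "dickson t (i + j) * dickson t (i - j) = (dickson t i)\<^sup>2 + (dickson t j)\<^sup>2 - 4"
    by linarith
qed

text \<open>With \<open>h^2 = g\<close>, \<open>dickson t n - 2\<close> is the square of
  \<open>h^n - h^(-n)\<close>. This is the squared analogue of the product formula for sin (x + y) *
  sin (x - y).\<close>

lemma dickson_minus_2_mult:
  assumes "t \<ge> 3" "j \<le> i"
  shows "(dickson t (i + j) - 2) * (dickson t (i - j) - 2) = (dickson t i - dickson t j)\<^sup>2"
  using dickson_add_diff[OF assms] by (simp add: algebra_simps power2_eq_square)

section \<open>Rank of apparition of a prime\<close>

lemma prime_dvd_dickson_add_diff: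
  fixes p :: int
  assumes "t \<ge> 3" "j \<le> i" "prime p" "p dvd dickson t i - 2" "p dvd dickson t j - 2"
  shows "p dvd dickson t (i + j) - 2" "p dvd dickson t (i - j) - 2"
proof -
  \<comment> \<open>The prime divides both the product and the sum of \<open>A\<close> and
    \<open>B\<close>, hence each of them.\<close>
  define A B where "A = dickson t (i + j) - 2" and "B = dickson t (i - j) - 2"
  have "p dvd (dickson t i - 2) - (dickson t j - 2)"
    using assms(4,5) by (rule dvd_diff)
  then have "p dvd (dickson t i - dickson t j)\<^sup>2"
    by (simp add: power2_eq_square)
  then have "p dvd A * B"
    using dickson_minus_2_mult[OF assms(1,2)] by (simp add: A_def B_def)
  then have AB: "p dvd A \<or> p dvd B"
    using assms(3) by (simp add: prime_dvd_mult_iff)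
  have "A + B = dickson t i * (dickson t j - 2) + 2 * (dickson t i - 2)"
    using dickson_add_diff(1)[OF assms(1,2)] by (simp add: A_def B_def algebra_simps)
  then have "p dvd A + B" using assms(4,5) by (metis dvd_add dvd_mult)
  with AB show "p dvd dickson t (i + j) - 2" "p dvd dickson t (i - j) - 2"
    unfolding A_def[symmetric] B_def[symmetric]
    by (auto simp: dvd_add_right_iff dvd_add_left_iff)
qed

text \<open>\<open>LEAST\<close> is meaningful only if a suitable index exists;
  \<open>dickson_rank_le\<close> provides one for every prime \<open>p\<close> and
  \<open>t \<ge> 3\<close>.\<close>

definition dickson_rank :: "int \<Rightarrow> nat \<Rightarrow> nat" where
  "dickson_rank t p = (LEAST m. 0 < m \<and> int p dvd dickson t m - 2)"

text \<open>The indices in question are closed under sums and differences, so they are the multiples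
  of the least positive one.\<close>

lemma dickson_rank_dvd_iff:
  assumes "t \<ge> 3" "prime p" "0 < m0" "int p dvd dickson t m0 - 2"
  shows "0 < dickson_rank t p" "int p dvd dickson t n - 2 \<longleftrightarrow> dickson_rank t p dvd n"
proof -
  define r where "r = dickson_rank t p"
  have r: "0 < r" "int p dvd dickson t r - 2"
    using LeastI[of "\<lambda>m. 0 < m \<and> int p dvd dickson t m - 2" m0] assms(3,4)
    by (auto simp: r_def dickson_rank_def)
  have least: "r \<le> m" if "0 < m" "int p dvd dickson t m - 2" for m
    using that Least_le[of "\<lambda>m. 0 < m \<and> int p dvd dickson t m - 2" m]
    by (auto simp: r_def dickson_rank_def)
  note pr = prime_dvd_dickson_add_diff[OF assms(1), where p = "int p"]
  show "0 < dickson_rank t p" using r r_def by simp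
  have *: "int p dvd dickson t (r * k) - 2" for k
  proof (induction k)
    case (Suc k)
    show ?case
    \<comment> \<open>Adding \<open>r\<close> to \<open>r * k\<close> by \<open>pr\<close> requires
      \<open>r \<le> r * k\<close>, which fails at \<open>k = 0\<close>.\<close>
    proof (cases k)
      case 0
      then show ?thesis using r by simp
    next
      case (Suc l)
      then have "r \<le> r * k" by simp
      from pr(1)[OF this] show ?thesis using Suc.IH r assms(2) by (simp add: add.commute)
    qed
  qed simp
  show "int p dvd dickson t n - 2 \<longleftrightarrow> dickson_rank t p dvd n"
    unfolding r_def[symmetric]
  proof
    assume n: "int p dvd dickson t n - 2"
    have "int p dvd dickson t (n - r * (n div r)) - 2"
      using pr(2)[of "r * (n div r)" n] n * assms(2) by simp
    then have "int p dvd dickson t (n mod r) - 2"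
      by (simp add: minus_mult_div_eq_mod)
    then have "n mod r = 0"
      using least[of "n mod r"] r(1) mod_less_divisor[OF r(1), of n] by fastforce
    then show "r dvd n" by auto
  qed (use * in auto)
qed

section \<open>Exponent of a prime when the index is multiplied\<close>

text \<open>For \<open>t = h\<^sup>2 + h ^ (-2)\<close>, \<open>X\<close> is the square of \<open>(h ^ k - h ^ (-k)) / (h - h ^ (-1))\<close>, and the
  square of the denominator is \<open>t - 2\<close>.\<close>
lemma dickson_minus_2_quotient:
  obtains X where "dickson t k - 2 = (t - 2) * X" "t - 2 dvd X - (int k)\<^sup>2"
proof -
  have "\<exists>X. dickson t k - 2 = (t - 2) * X \<and> t - 2 dvd X - (int k)\<^sup>2"
  proof (induction t k rule: dickson.induct)
    case (3 t k)
    then obtain X Y where X: "dickson t (Suc k) - 2 = (t - 2) * X" "t - 2 dvd X - (int (Suc k))\<^sup>2"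
      and Y: "dickson t k - 2 = (t - 2) * Y" "t - 2 dvd Y - (int k)\<^sup>2" by blast
    have 1: "dickson t (Suc (Suc k)) - 2 = (t - 2) * (t * X - Y + 2)"
    proof -
      have 1: "dickson t (Suc k) = (t - 2) * X + 2" and 2: "dickson t k = (t - 2) * Y + 2"
        using X(1) Y(1) by simp_all
      show ?thesis unfolding dickson.simps 1 2 by (simp add: algebra_simps)
    qed
    have "t * X - Y + 2 - (int (Suc (Suc k)))\<^sup>2
        = 2 * (X - (int (Suc k))\<^sup>2) - (Y - (int k)\<^sup>2) + (t - 2) * X"
      by (simp add: algebra_simps power2_eq_square)
    then have "t - 2 dvd t * X - Y + 2 - (int (Suc (Suc k)))\<^sup>2"
      using X(2) Y(2) by (metis dvd_add dvd_diff dvd_mult dvd_triv_left)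
    with 1 show ?case by blast
  qed (auto intro: exI[of _ 0] exI[of _ 1])
  with that show ?thesis by blast
qed

text \<open>The quotient \<open>X\<close> is congruent to \<open>k^2\<close> modulo
  \<open>dickson t m - 2\<close>, hence modulo \<open>p\<close>, so it contributes no factor
  \<open>p\<close>.\<close>

lemma multiplicity_dickson_mult_coprime:
  assumes "t \<ge> 3" "prime p" "0 < m" "int p dvd dickson t m - 2" "\<not> p dvd k"
  shows "multiplicity (int p) (dickson t (m * k) - 2) = multiplicity (int p) (dickson t m - 2)"
proof -
  obtain X where X: "dickson t (m * k) - 2 = (dickson t m - 2) * X"
      "dickson t m - 2 dvd X - (int k)\<^sup>2"
    using dickson_minus_2_quotient[of "dickson t m" k] dickson_mult[OF assms(1)] by metis
  have "\<not> int p dvd X"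
  proof
    assume "int p dvd X"
    moreover have "int p dvd X - (int k)\<^sup>2" using X(2) assms(4) dvd_trans by blast
    ultimately have "int p dvd (int k)\<^sup>2" by (metis dvd_diff_right_iff)
    then show False using assms(2,5) by (simp add: prime_dvd_power_iff)
  qed
  moreover from this have "X \<noteq> 0" by auto
  moreover have "dickson t m - 2 \<noteq> 0" using dickson_ge_3[OF assms(1,3)] by simp
  ultimately show ?thesis
    using assms(2) by (simp add: X prime_elem_multiplicity_mult_distrib not_dvd_imp_multiplicity_0)
qed

text \<open>The inner sum is \<open>g^(-h) + ... + g^h\<close>, so its product with
  \<open>t - 2\<close> telescopes to \<open>dickson t (Suc h) - dickson t h\<close>. The square of
  this is given by \<open>dickson_minus_2_mult\<close>, the indices having sum
  \<open>2 * h + 1\<close> and difference 1.\<close>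

lemma dickson_odd:
  assumes "t \<ge> 3"
  shows "dickson t (2 * h + 1) - 2 = (t - 2) * (1 + (\<Sum>i=1..h. dickson t i))\<^sup>2"
proof -
  define S where "S = 1 + (\<Sum>i=1..h. dickson t i)"
  have "(t - 2) * S = dickson t (Suc h) - dickson t h"
    unfolding S_def
  proof (induction h)
    case (Suc h)
    have "(t - 2) * (1 + (\<Sum>i=1..Suc h. dickson t i))
        = (t - 2) * (1 + (\<Sum>i=1..h. dickson t i)) + (t - 2) * dickson t (Suc h)"
      by (simp add: distrib_left)
    also have "\<dots> = dickson t (Suc (Suc h)) - dickson t (Suc h)"
      unfolding Suc.IH dickson.simps by (simp add: left_diff_distrib)
    finally show ?case .
  qed simp
  moreover have "(t - 2) * ((t - 2) * S\<^sup>2) = ((t - 2) * S)\<^sup>2"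
    by (simp add: power2_eq_square)
  ultimately have "(t - 2) * ((t - 2) * S\<^sup>2) = (dickson t (Suc h) - dickson t h)\<^sup>2"
    by simp
  also have "\<dots> = (dickson t (Suc h + h) - 2) * (dickson t (Suc h - h) - 2)"
    using dickson_minus_2_mult[OF assms, of h "Suc h"] by simp
  also have "Suc h + h = 2 * h + 1" by simp
  also have "dickson t (Suc h - h) = t" by (simp add: Suc_diff_le)
  finally have "(t - 2) * ((t - 2) * S\<^sup>2) = (t - 2) * (dickson t (2 * h + 1) - 2)"
    by (simp only: mult.commute)
  then show ?thesis using assms unfolding S_def by simp
qed

lemma multiplicity_eq_1:
  fixes p x :: int
  assumes "prime p" "p\<^sup>2 dvd x - p"
  shows "multiplicity p x = 1"
proof (rule multiplicity_eqI)
  have "p dvd x - p" using assms(2) by (metis dvd_trans dvd_triv_left power2_eq_square)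
  then show "p ^ 1 dvd x" using dvd_add[of p "x - p" p] by simp
  show "\<not> p ^ Suc 1 dvd x"
  proof
    assume "p ^ Suc 1 dvd x"
    then have "p ^ 2 dvd p ^ 1"
      using assms(2) by (simp add: numeral_2_eq_2 dvd_diff_right_iff)
    then have "p dvd 1" using assms(1) by (auto simp: power2_eq_square)
    then show False using assms(1) not_prime_unit by blast
  qed
qed

text \<open>When only a low power of 2 or 3 divides \<open>dickson t m - 2\<close>, the exponent gained at that prime is
  not determined; hence the two extra hypotheses.\<close>
lemma multiplicity_dickson_mult_prime:
  assumes "t \<ge> 3" "prime p" "0 < m" "int p dvd dickson t m - 2"
    and "p = 2 \<Longrightarrow> 8 dvd dickson t m - 2" "p = 3 \<Longrightarrow> 9 dvd dickson t m - 2"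
  shows "multiplicity (int p) (dickson t (m * p) - 2) = multiplicity (int p) (dickson t m - 2) + 2"
proof -
  define T where "T = dickson t m"
  have T: "T \<ge> 3" unfolding T_def using assms by (intro dickson_ge_3)
  have pT: "int p dvd T - 2" using assms by (simp add: T_def)
  have prime: "prime (int p)" using assms by simp
  \<comment> \<open>By \<open>dickson_mult\<close> it suffices to compare the indices 1 and
    \<open>p\<close> for the trace \<open>T\<close>.\<close>
  have main: "multiplicity (int p) (dickson T p - 2) = multiplicity (int p) (T - 2) + 2"
  proof (cases "p = 2")
    case True
    obtain c where c: "T - 2 = 8 * c" using assms(5)[OF True] by (auto simp: T_def)
    \<comment> \<open>For \<open>p = 2\<close> the quotient is \<open>T + 2\<close>, which is 4
      modulo 8.\<close>
    have "T + 2 = 4 * (2 * c + 1)" using c by simp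
    then have "(2::int) ^ 2 dvd T + 2" "\<not> (2::int) ^ Suc 2 dvd T + 2"
      by (simp_all add: eval_nat_numeral, presburger)
    then have "multiplicity 2 (T + 2) = 2" by (rule multiplicity_eqI)
    moreover have "dickson T p - 2 = (T - 2) * (T + 2)"
      by (simp add: True dickson_2 power2_eq_square algebra_simps)
    ultimately show ?thesis
      using T by (simp add: True prime_elem_multiplicity_mult_distrib)
  next
    case False
    then have "odd p" using assms(2) primes_dvd_imp_eq two_is_prime_nat by blast
    then obtain h where h: "p = 2 * h + 1" by (metis oddE)
    define S where "S = 1 + (\<Sum>i=1..h. dickson T i)"
    \<comment> \<open>By \<open>dickson_odd\<close> the quotient is the square of \<open>S\<close>.
      Being congruent to \<open>p\<close> modulo \<open>p^2\<close>, \<open>S\<close> has exactly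
      one factor \<open>p\<close>, and its square has two.\<close>
    have "(int p)\<^sup>2 dvd S - int p"
    proof (cases "p = 3")
      case True
      then have "h = 1" using h by simp
      then have "S - int p = T - 2" by (simp add: S_def True)
      then show ?thesis using assms(6)[OF True] by (simp add: True T_def)
    next
      case p3: False
      \<comment> \<open>Modulo \<open>(T - 2)^2\<close>, hence modulo \<open>p^2\<close>,
        \<open>S - p\<close> becomes \<open>T - 2\<close> times the sum of the \<open>i^2\<close>.
        That sum is \<open>h * (h + 1) * p / 6\<close>, which is divisible by \<open>p\<close> since
        \<open>p > 3\<close>.\<close>
      have dvd: "(T - 2)\<^sup>2 dvd dickson T i - 2 - (T - 2) * (int i)\<^sup>2" for i
      proof -
        obtain X where X: "dickson T i - 2 = (T - 2) * X" "T - 2 dvd X - (int i)\<^sup>2"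
          by (rule dickson_minus_2_quotient)
        have "dickson T i - 2 - (T - 2) * (int i)\<^sup>2 = (T - 2) * (X - (int i)\<^sup>2)"
          by (simp add: X(1) right_diff_distrib)
        then show ?thesis using X(2) by (simp add: power2_eq_square)
      qed
      have "S - int p = (\<Sum>i=1..h. dickson T i - 2)"
        by (simp add: S_def h sum_subtractf)
      also have "\<dots> = (\<Sum>i=1..h. dickson T i - 2 - (T - 2) * (int i)\<^sup>2)
          + (T - 2) * (\<Sum>i=1..h. (int i)\<^sup>2)"
        by (simp add: sum_subtractf sum_distrib_left)
      finally have S: "S - int p = \<dots>" .
      have "6 * (\<Sum>i=1..h. (int i)\<^sup>2) = int h * (int h + 1) * int p"
      proof -
        have "6 * (\<Sum>i=1..h. (int i)\<^sup>2) = int h * (int h + 1) * (2 * int h + 1)"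
        proof (induction h)
          case (Suc h)
          have "6 * (\<Sum>i=1..Suc h. (int i)\<^sup>2)
              = 6 * (\<Sum>i=1..h. (int i)\<^sup>2) + 6 * (int h + 1)\<^sup>2"
            by (simp add: add.commute)
          then show ?case unfolding Suc.IH by (simp add: power2_eq_square algebra_simps)
        qed simp
        then show ?thesis by (simp add: h add.commute)
      qed
      then have "int p dvd 6 * (\<Sum>i=1..h. (int i)\<^sup>2)" by simp
      moreover have "\<not> int p dvd 6"
      proof
        assume "int p dvd 6"
        then have "p dvd 2 * 3" by presburger
        then have "p dvd 2 \<or> p dvd 3" using assms(2) prime_dvd_multD by blast
        then show False using False p3 assms(2) by (auto simp: primes_dvd_imp_eq)
      qed
      ultimately have "int p dvd (\<Sum>i=1..h. (int i)\<^sup>2)"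
        using prime by (simp add: prime_dvd_mult_iff)
      then have "(int p)\<^sup>2 dvd (T - 2) * (\<Sum>i=1..h. (int i)\<^sup>2)"
        using pT by (simp add: power2_eq_square mult_dvd_mono)
      moreover have "(int p)\<^sup>2 dvd (\<Sum>i=1..h. dickson T i - 2 - (T - 2) * (int i)\<^sup>2)"
        by (intro dvd_sum dvd_trans[OF _ dvd]) (simp add: pT dvd_power_same)
      ultimately show ?thesis unfolding S by simp
    qed
    then have "multiplicity (int p) S = 1" by (rule multiplicity_eq_1[OF prime])
    moreover from this have "S \<noteq> 0" by auto
    moreover have "dickson T p - 2 = (T - 2) * (S * S)"
      using dickson_odd[OF T, of h] by (simp add: h S_def power2_eq_square)
    ultimately show ?thesis
      using T prime by (simp add: prime_elem_multiplicity_mult_distrib)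
  qed
  then show ?thesis by (simp add: T_def dickson_mult[OF assms(1)])
qed

text \<open>Modulo \<open>p\<close>, the expansion of \<open>t ^ p = (g + 1 / g) ^ p\<close> leaves
  \<open>g ^ p + g ^ (-p)\<close>, and Fermat's little theorem turns \<open>t ^ p\<close> into
  \<open>t\<close>. Adding the expansion to its mirror image makes every term an integer but costs a
  factor 2, hence the separate case \<open>p = 2\<close>.\<close>

lemma dickson_prime_cong:
  assumes "t \<ge> 3" "prime p"
  shows "int p dvd dickson t p - t"
proof (cases "p = 2")
  case True
  have "dickson t 2 - t = t * (t - 1) - 2" by (simp add: dickson_2 power2_eq_square algebra_simps)
  then show ?thesis using True by simp
next
  case False
  obtain g :: real where g: "g \<ge> 2.6" "of_int t = g + 1 / g"
    using dickson_root[OF assms(1)] .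
  \<comment> \<open>\<open>e k\<close> is \<open>g ^ (p - 2 * k)\<close> plus its inverse; the two
    branches keep natural subtraction from truncating.\<close>
  define e where "e k = (if k \<le> p - k then dickson t (p - 2 * k) else dickson t (2 * k - p))" for k
  have e: "real_of_int (e k) = g ^ k * (1 / g) ^ (p - k) + (1 / g) ^ k * g ^ (p - k)"
    if "k \<le> p" for k
  proof (cases "k \<le> p - k")
    case True
    then have "p - k = k + (p - 2 * k)" by simp
    then obtain a where a: "p - k = k + a" "p - 2 * k = a" by blast
    then have "g ^ (p - k) = g ^ k * g ^ a" by (simp only: power_add)
    then show ?thesis using g True a(2) of_int_dickson[of g t a]
      by (simp add: e_def power_one_over)
  next
    case False
    define a where "a = 2 * k - p"
    have a: "k = (p - k) + a" "2 * k - p = a" using False that by (simp_all add: a_def)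
    have "g ^ k = g ^ (p - k) * g ^ a"
      by (subst a(1)) (rule power_add)
    then show ?thesis using g False a(2) of_int_dickson[of g t a]
      by (simp add: e_def power_one_over)
  qed
  have e0: "e 0 = dickson t p" "e p = dickson t p" by (simp_all add: e_def)
  have "real_of_int (2 * t ^ p) = (g + 1 / g) ^ p + (1 / g + g) ^ p"
    by (simp add: g(2) add.commute[of "1 / g"])
  also have "\<dots> = (\<Sum>k\<le>p. of_nat (p choose k) * of_int (e k))"
    unfolding binomial_ring sum.distrib[symmetric]
    by (rule sum.cong) (simp_all add: e distrib_left mult.assoc)
  finally have "2 * t ^ p = (\<Sum>k\<le>p. int (p choose k) * e k)"
  proof -
    assume "real_of_int (2 * t ^ p) = (\<Sum>k\<le>p. of_nat (p choose k) * of_int (e k))"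
    also have "\<dots> = real_of_int (\<Sum>k\<le>p. int (p choose k) * e k)" by simp
    finally show ?thesis by (simp only: of_int_eq_iff)
  qed
  also have "{..p} = insert 0 (insert p {0<..<p})" using assms(2) by (auto simp: prime_gt_0_nat)
  also have "(\<Sum>k\<in>insert 0 (insert p {0<..<p}). int (p choose k) * e k)
      = 2 * dickson t p + (\<Sum>k\<in>{0<..<p}. int (p choose k) * e k)"
    using prime_gt_0_nat[OF assms(2)] by (simp add: e0)
  finally have "2 * (dickson t p - t ^ p) = - (\<Sum>k\<in>{0<..<p}. int (p choose k) * e k)" by simp
  moreover have "int p dvd (\<Sum>k\<in>{0<..<p}. int (p choose k) * e k)"
    using assms(2) by (intro dvd_sum dvd_mult2) (auto intro!: dvd_choose_prime)
  ultimately have "int p dvd 2 * (dickson t p - t ^ p)" by simp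
  moreover have "\<not> int p dvd 2"
    using primes_dvd_imp_eq[OF assms(2) two_is_prime_nat] False int_dvd_int_iff[of p 2] by auto
  ultimately have 1: "int p dvd dickson t p - t ^ p"
    using assms(2) prime_dvd_mult_iff[of "int p" 2 "dickson t p - t ^ p"] by auto
  have 2: "int p dvd t ^ p - t"
  proof (cases "int p dvd t")
    case True
    moreover have "t dvd t ^ p" using prime_gt_0_nat[OF assms(2)] by (simp add: dvd_power)
    ultimately show ?thesis by (meson dvd_diff dvd_trans)
  next
    case False
    define u where "u = nat t"
    have u: "t = int u" using assms(1) by (simp add: u_def)
    then have "[u ^ (p - 1) = 1] (mod p)" using False assms(2) by (intro fermat_theorem) auto
    then have "[u * u ^ (p - 1) = u * 1] (mod p)" by (rule cong_scalar_left)
    then have "[u ^ p = u] (mod p)" using prime_gt_0_nat[OF assms(2)]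
      by (simp flip: power_Suc)
    then have "[t ^ p = t] (mod int p)"
      using cong_int_iff[of "u ^ p" u p] by (simp add: u)
    then show ?thesis by (simp add: cong_iff_dvd_diff)
  qed
  show ?thesis using dvd_add[OF 1 2] by simp
qed

text \<open>\<open>p\<close> divides the square of \<open>dickson t p - dickson t 1\<close>, which
  is the product of the terms at \<open>p + 1\<close> and \<open>p - 1\<close>; so \<open>p\<close>
  divides one of these terms.\<close>

lemma dickson_rank_le:
  assumes "t \<ge> 3" "prime p"
  shows "\<exists>m>0. int p dvd dickson t m - 2" "dickson_rank t p \<le> p + 1"
proof -
  have p: "p \<ge> 2" using assms(2) by (rule prime_ge_2_nat)
  have "int p dvd (dickson t p - dickson t 1)\<^sup>2"
    using dickson_prime_cong[OF assms] by (simp add: power2_eq_square)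
  then have "int p dvd (dickson t (p + 1) - 2) * (dickson t (p - 1) - 2)"
    using dickson_minus_2_mult[OF assms(1), of 1 p] p by simp
  then have "int p dvd dickson t (p + 1) - 2 \<or> int p dvd dickson t (p - 1) - 2"
    using assms(2) by (simp add: prime_dvd_mult_iff del: add_Suc_right)
  then obtain m where m: "0 < m" "m \<le> p + 1" "int p dvd dickson t m - 2"
  proof
    assume "int p dvd dickson t (p - 1) - 2"
    then show ?thesis using that[of "p - 1"] p by simp
  qed (use that[of "p + 1"] in simp)
  then show "\<exists>m>0. int p dvd dickson t m - 2" by blast
  show "dickson_rank t p \<le> p + 1"
    unfolding dickson_rank_def using m
    by (intro order_trans[OF Least_le[of _ m]]) auto
qed

lemma dickson_minus_2_dvd:
  assumes "t \<ge> 3" "m dvd n"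
  shows "dickson t m - 2 dvd dickson t n - 2"
proof -
  obtain k where "n = m * k" using assms(2) by (elim dvdE)
  then show ?thesis
    using dickson_minus_2_quotient[of "dickson t m" k] dickson_mult[OF assms(1), of m k]
    by (metis dvd_triv_left)
qed

text \<open>The quotient is \<open>dickson t m + 2\<close>, which is even. Doubling and tripling the
  index supply the hypotheses on 8 and 9 in \<open>multiplicity_dickson_mult_prime\<close>.\<close>

lemma dvd_dickson_double:
  assumes "t \<ge> 3" "2 * c dvd dickson t m - 2"
  shows "4 * c dvd dickson t (2 * m) - 2"
proof -
  have "dickson t (m * 2) - 2 = (dickson t m - 2) * (dickson t m + 2)"
    unfolding dickson_mult[OF assms(1), symmetric]
    by (simp add: dickson_2 power2_eq_square power3_eq_cube algebra_simps)
  moreover have "even (dickson t m)"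
    using assms(2) by (metis dvd_mult_left even_diff even_numeral add.commute diff_add_cancel dvd_add dvd_refl)
  then have "2 * c * 2 dvd (dickson t m - 2) * (dickson t m + 2)"
    using assms(2) by (intro mult_dvd_mono) auto
  ultimately show ?thesis by (simp add: mult.commute mult.left_commute)
qed

lemma dvd_dickson_triple:
  assumes "t \<ge> 3" "3 dvd dickson t m - 2"
  shows "9 dvd dickson t (3 * m) - 2"
proof -
  have "dickson t (m * 3) - 2 = (dickson t m - 2) * (dickson t m + 1)\<^sup>2"
    unfolding dickson_mult[OF assms(1), symmetric]
    by (simp add: dickson_3 power2_eq_square power3_eq_cube algebra_simps)
  moreover have "3 dvd dickson t m + 1" using assms(2) by presburger
  then have "3 * 3 dvd (dickson t m - 2) * (dickson t m + 1)\<^sup>2"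
    using assms(2) by (intro mult_dvd_mono) (auto simp: power2_eq_square)
  ultimately show ?thesis by (simp add: mult.commute)
qed

section \<open>Alternating sums over square-free divisors\<close>

text \<open>The Moebius sum of \<open>f\<close> over the divisors of \<open>n\<close>, restricted to its nonzero terms: the subset
  \<open>S\<close> stands for the square-free divisor \<open>\<Prod>S\<close>.\<close>
definition mobius_sum :: "nat \<Rightarrow> (nat \<Rightarrow> real) \<Rightarrow> real" where
  "mobius_sum n f = (\<Sum>S\<in>Pow (prime_factors n). (-1) ^ card S * f (n div \<Prod>S))"

lemma prod_primes_dvd:
  fixes k :: nat
  assumes "finite S" "\<And>p. p \<in> S \<Longrightarrow> prime p \<and> p dvd k"
  shows "\<Prod>S dvd k"
  using assms
proof (induction S rule: finite_induct)
  case (insert q S)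
  have "coprime q (\<Prod>S)"
    using insert.hyps(2) insert.prems by (intro prod_coprime_right primes_coprime) auto
  moreover have "\<Prod>S dvd k" "q dvd k" using insert.IH insert.prems by auto
  ultimately show ?case using insert.hyps by (simp add: divides_mult)
qed simp

lemma prod_primes_dvd_subset:
  fixes n :: nat
  assumes "S \<subseteq> prime_factors n"
  shows "\<Prod>S dvd n"
  using assms by (intro prod_primes_dvd) (auto intro: finite_subset)

lemma prime_dvd_prod_primes_iff:
  fixes q :: nat
  assumes "finite S" "\<And>p. p \<in> S \<Longrightarrow> prime p" "prime q"
  shows "q dvd \<Prod>S \<longleftrightarrow> q \<in> S"
  unfolding prime_dvd_prod_iff[OF assms(1,3)]
  using assms(2,3) primes_dvd_imp_eq by (metis dvd_refl)

text \<open>Each \<open>S\<close> avoiding \<open>q\<close> is paired with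
  \<open>insert q S\<close>. A sum can then be shown to vanish by comparing \<open>f\<close> at two
  arguments whose ratio is \<open>q\<close>.\<close>

lemma mobius_sum_split:
  assumes "q \<in> prime_factors n"
  shows "mobius_sum n f = (\<Sum>S\<in>Pow (prime_factors n - {q}).
           (-1) ^ card S * (f (n div \<Prod>S) - f (n div (\<Prod>S * q))))"
proof -
  define P where "P = prime_factors n - {q}"
  have P: "prime_factors n = insert q P" "q \<notin> P" "finite P" using assms by (auto simp: P_def)
  define h where "h S = (-1) ^ card S * f (n div \<Prod>S)" for S
  have "mobius_sum n f = (\<Sum>S\<in>Pow P \<union> insert q ` Pow P. h S)"
    by (simp add: mobius_sum_def P(1) Pow_insert h_def)
  also have "\<dots> = sum h (Pow P) + sum h (insert q ` Pow P)"
    using P by (intro sum.union_disjoint) auto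
  also have "sum h (insert q ` Pow P) = (\<Sum>S\<in>Pow P. h (insert q S))"
    using P(2) by (subst sum.reindex) (auto simp: inj_on_def)
  also have "\<dots> = (\<Sum>S\<in>Pow P. - ((-1) ^ card S * f (n div (\<Prod>S * q))))"
  proof (rule sum.cong)
    fix S assume "S \<in> Pow P"
    then have "finite S" "q \<notin> S" using P finite_subset by auto
    then show "h (insert q S) = - ((-1) ^ card S * f (n div (\<Prod>S * q)))"
      by (simp add: h_def mult.commute)
  qed simp
  finally show ?thesis
    by (simp add: h_def P_def[symmetric] right_diff_distrib sum_subtractf sum_negf)
qed

lemma mobius_sum_lincomb:
  "mobius_sum n (\<lambda>d. \<Sum>q\<in>Q. c q * f q d) = (\<Sum>q\<in>Q. c q * mobius_sum n (f q))"
  unfolding mobius_sum_def sum_distrib_left by (subst sum.swap) (simp add: mult.left_commute)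

text \<open>This is Euler's product for the totient, multiplied out.\<close>

lemma mobius_sum_of_nat: "mobius_sum n real = real (totient n)"
proof -
  have "real (totient n) = real n * (\<Prod>p\<in>prime_factors n. - (1 / real p) + 1)"
    by (simp add: totient_formula2)
  also have "(\<Prod>p\<in>prime_factors n. - (1 / real p) + 1)
      = (\<Sum>S\<in>Pow (prime_factors n). \<Prod>p\<in>S. - (1 / real p))"
    by (subst prod_add) auto
  also have "real n * \<dots> = (\<Sum>S\<in>Pow (prime_factors n). (-1) ^ card S * real (n div \<Prod>S))"
    unfolding sum_distrib_left
  proof (rule sum.cong)
    fix S assume "S \<in> Pow (prime_factors n)"
    then have "\<Prod>S dvd n" by (intro prod_primes_dvd_subset) auto
    then have "real (n div \<Prod>S) = real n / (\<Prod>p\<in>S. real p)"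
      by (simp add: real_of_nat_div)
    moreover have "(\<Prod>p\<in>S. - (1 / real p)) = (-1) ^ card S / (\<Prod>p\<in>S. real p)"
    proof -
      have "(\<Prod>p\<in>S. - (1 / real p)) = (\<Prod>p\<in>S. -1 / real p)" by simp
      also have "\<dots> = (-1) ^ card S / (\<Prod>p\<in>S. real p)"
        by (subst prod_dividef) simp
      finally show ?thesis .
    qed
    ultimately show "real n * (\<Prod>p\<in>S. - (1 / real p)) = (-1) ^ card S * real (n div \<Prod>S)"
      by simp
  qed simp
  finally show ?thesis by (simp add: mobius_sum_def)
qed

text \<open>Distinct \<open>S\<close> give distinct arguments in \<open>{1..n}\<close>. As
  \<open>h\<close> is nonpositive there, giving every term a plus sign and then adding the missing
  arguments can only lower the sum.\<close>

lemma mobius_sum_ge: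
  assumes "n > 0" "\<And>d. d > 0 \<Longrightarrow> h d \<le> 0"
  shows "mobius_sum n h \<ge> (\<Sum>d=1..n. h d)"
proof -
  define P where "P = prime_factors n"
  define D where "D = (\<lambda>S. n div \<Prod>S) ` Pow P"
  have pos: "n div \<Prod>S > 0 \<and> n div \<Prod>S \<le> n \<and> n = (n div \<Prod>S) * \<Prod>S" if "S \<subseteq> P" for S
  proof -
    have dvd: "\<Prod>S dvd n" using prod_primes_dvd_subset that by (simp add: P_def)
    then have "n = (n div \<Prod>S) * \<Prod>S" by simp
    moreover from this have "n div \<Prod>S > 0" using assms(1) by (metis gr0I mult_0)
    ultimately show ?thesis by simp
  qed
  have inj: "inj_on (\<lambda>S. n div \<Prod>S) (Pow P)"
  proof (rule inj_onI)
    fix S T assume ST: "S \<in> Pow P" "T \<in> Pow P" "n div \<Prod>S = n div \<Prod>T"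
    have *: "n = (n div \<Prod>S) * \<Prod>S" "n = (n div \<Prod>T) * \<Prod>T" "n div \<Prod>S > 0"
      using pos[of S] pos[of T] ST(1,2) by (blast, blast, blast)
    then have "(n div \<Prod>S) * \<Prod>S = (n div \<Prod>S) * \<Prod>T" using ST(3) by metis
    then have eq: "\<Prod>S = \<Prod>T" using *(3) by simp
    have fin: "finite S" "finite T" using ST finite_subset by (auto simp: P_def)
    have prime: "prime q" if "q \<in> S \<or> q \<in> T" for q using that ST by (auto simp: P_def)
    have "q \<in> S \<longleftrightarrow> q \<in> T" for q
      using prime prime_dvd_prod_primes_iff[OF fin(1), of q] prime_dvd_prod_primes_iff[OF fin(2), of q] eq
      by metis
    then show "S = T" by blast
  qed
  have "(\<Sum>d=1..n. h d) \<le> sum h D"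
  proof (rule sum_mono2[of "{1..n}" D "\<lambda>d. - h d", simplified sum_negf neg_le_iff_le])
    show "D \<subseteq> {1..n}" using pos by (auto simp: D_def Suc_le_eq)
  qed (use assms(2) in auto)
  also have "sum h D = (\<Sum>S\<in>Pow P. h (n div \<Prod>S))"
    unfolding D_def using inj by (simp add: sum.reindex)
  also have "\<dots> \<le> mobius_sum n h"
    unfolding mobius_sum_def P_def[symmetric]
  proof (rule sum_mono)
    fix S assume "S \<in> Pow P"
    then have "h (n div \<Prod>S) \<le> 0" using pos assms(2) by auto
    then show "h (n div \<Prod>S) \<le> (-1) ^ card S * h (n div \<Prod>S)"
      by (cases "even (card S)") auto
  qed
  finally show ?thesis .
qed

text \<open>After splitting at \<open>q\<close>, the paired arguments are \<open>m * q\<close> and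
  \<open>m\<close>. The rank divides both or neither, and a factor \<open>q\<close> other than
  \<open>p\<close> does not change the exponent of \<open>p\<close>.\<close>

lemma mobius_sum_multiplicity_eq_0:
  assumes "t \<ge> 3" "prime p" "n > 0" "dickson_rank t p dvd n"
    and "prime q" "q \<noteq> p" "q dvd n div dickson_rank t p"
  shows "mobius_sum n (\<lambda>d. real (multiplicity (int p) (dickson t d - 2))) = 0"
proof -
  define r where "r = dickson_rank t p"
  obtain m0 where m0: "m0 > 0" "int p dvd dickson t m0 - 2"
    using dickson_rank_le(1)[OF assms(1,2)] by blast
  have r: "r > 0" "int p dvd dickson t m - 2 \<longleftrightarrow> r dvd m" for m
    using dickson_rank_dvd_iff[OF assms(1,2) m0] by (auto simp: r_def)
  obtain k where k: "n = r * k" using assms(4) by (auto simp: r_def)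
  have qk: "q dvd k" using assms(7) r(1) by (simp add: k r_def[symmetric])
  have qn: "q \<in> prime_factors n"
    using assms(3,5) qk k by (simp add: prime_factors_dvd)
  have "multiplicity (int p) (dickson t (n div \<Prod>S) - 2)
      = multiplicity (int p) (dickson t (n div (\<Prod>S * q)) - 2)"
    if S: "S \<subseteq> prime_factors n - {q}" for S
  proof -
    define s where "s = \<Prod>S"
    have fin: "finite S" and pr: "x \<in> S \<Longrightarrow> prime x" for x using S finite_subset by auto
    have qs: "coprime q s"
      using S assms(5) prime_dvd_prod_primes_iff[OF fin pr assms(5)]
      by (auto simp: s_def prime_imp_coprime)
    have "s dvd n" using S prod_primes_dvd_subset by (auto simp: s_def)
    then have "s * q dvd n" using qn qs by (intro divides_mult) (auto simp: coprime_commute)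
    then obtain m where m: "n = s * q * m" by (elim dvdE)
    then have pos: "s > 0" "q > 0" "m > 0" using assms(3) by auto
    have eq: "n div s = m * q" "n div (s * q) = m" using pos by (simp_all add: m)
    show ?thesis
    proof (cases "r dvd m")
      case True
      then have "multiplicity (int p) (dickson t (m * q) - 2) = multiplicity (int p) (dickson t m - 2)"
        using assms r pos(3) by (intro multiplicity_dickson_mult_coprime) (auto dest: primes_dvd_imp_eq)
      then show ?thesis by (simp only: s_def[symmetric] eq)
    next
      case False
      \<comment> \<open>If \<open>m * q = r * l\<close>, then \<open>k = s * l\<close>; since
        \<open>q\<close> divides \<open>k\<close> but is coprime to \<open>s\<close>, it divides
        \<open>l\<close> and cancels.\<close>
      have "\<not> r dvd m * q"
      proof
        assume "r dvd m * q"
        then obtain l where l: "m * q = r * l" by (elim dvdE)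
        then have "r * k = r * (s * l)" using m k by (metis mult.assoc mult.left_commute mult.commute)
        then have "k = s * l" using r(1) by simp
        then have "q dvd l" using qk qs by (simp add: coprime_dvd_mult_right_iff)
        then obtain u where "l = q * u" by (elim dvdE)
        then have "m = r * u" using l pos(2) by (simp add: mult.commute mult.left_commute)
        then show False using False by simp
      qed
      then show ?thesis using False r(2) by (simp add: s_def[symmetric] eq not_dvd_imp_multiplicity_0)
    qed
  qed
  then show ?thesis by (subst mobius_sum_split[OF qn]) (simp add: Pow_def)
qed

text \<open>After splitting at \<open>p\<close>, a nonempty \<open>S\<close> removes from
  \<open>n\<close> a prime other than \<open>p\<close>. The rank cannot divide what remains, as its
  cofactor in \<open>n\<close> is a power of \<open>p\<close>; only the empty \<open>S\<close>
  contributes.\<close>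

lemma mobius_sum_multiplicity_prime_power:
  assumes "t \<ge> 3" "prime p" "n = dickson_rank t p * p ^ Suc j"
  shows "mobius_sum n (\<lambda>d. real (multiplicity (int p) (dickson t d - 2)))
       = real (multiplicity (int p) (dickson t n - 2))
         - real (multiplicity (int p) (dickson t (n div p) - 2))"
proof -
  define r where "r = dickson_rank t p"
  define f where "f d = real (multiplicity (int p) (dickson t d - 2))" for d
  obtain m0 where m0: "m0 > 0" "int p dvd dickson t m0 - 2"
    using dickson_rank_le(1)[OF assms(1,2)] by blast
  have r: "r > 0" "int p dvd dickson t m - 2 \<longleftrightarrow> r dvd m" for m
    using dickson_rank_dvd_iff[OF assms(1,2) m0] by (auto simp: r_def)
  have n: "n = r * p ^ Suc j" using assms(3) by (simp add: r_def)
  have n0: "n > 0" using r(1) n prime_gt_0_nat[OF assms(2)] by simp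
  have pn: "p \<in> prime_factors n" using n n0 assms(2) by (simp add: prime_factors_dvd)
  have zero: "f (n div \<Prod>S) - f (n div (\<Prod>S * p)) = 0"
    if S: "S \<subseteq> prime_factors n - {p}" "S \<noteq> {}" for S
  proof -
    define s where "s = \<Prod>S"
    obtain q where q: "q \<in> S" "prime q" "q \<noteq> p" using S by blast
    have fin: "finite S" and pr: "x \<in> S \<Longrightarrow> prime x" for x using S finite_subset by auto
    have qs: "q dvd s" using q prime_dvd_prod_primes_iff[OF fin pr q(2)] by (simp add: s_def)
    have ps: "coprime p s"
      using S assms(2) prime_dvd_prod_primes_iff[OF fin pr assms(2)]
      by (auto simp: s_def prime_imp_coprime)
    have "s dvd n" using S prod_primes_dvd_subset by (auto simp: s_def)
    then have "s * p dvd n" using pn ps by (intro divides_mult) (auto simp: coprime_commute)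
    then obtain m where m: "n = s * p * m" by (elim dvdE)
    then have pos: "s > 0" "p > 0" "m > 0" using n0 by auto
    have eq: "n div s = m * p" "n div (s * p) = m" using pos by (simp_all add: m)
    have "\<not> r dvd m * p"
    proof
      assume "r dvd m * p"
      then obtain l where l: "m * p = r * l" by (elim dvdE)
      then have "r * p ^ Suc j = r * (s * l)" using m n by (metis mult.assoc mult.left_commute mult.commute)
      then have "p ^ Suc j = s * l" using r(1) by simp
      then have "q dvd p ^ Suc j" using qs by (metis dvd_mult2)
      then show False using q assms(2) by (meson prime_dvd_power primes_dvd_imp_eq)
    qed
    moreover from this have "\<not> r dvd m" by auto
    ultimately show ?thesis
      using r(2) by (simp add: s_def[symmetric] eq f_def not_dvd_imp_multiplicity_0)
  qed
  have "mobius_sum n f = (\<Sum>S\<in>Pow (prime_factors n - {p}).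
          (-1) ^ card S * (f (n div \<Prod>S) - f (n div (\<Prod>S * p))))"
    by (rule mobius_sum_split[OF pn])
  also have "\<dots> = (\<Sum>S\<in>{{}}. (-1) ^ card S * (f (n div \<Prod>S) - f (n div (\<Prod>S * p))))"
    by (rule sum.mono_neutral_right) (use zero in auto)
  finally show ?thesis by (simp add: f_def[abs_def])
qed

text \<open>To be applied with \<open>a\<close> and \<open>b\<close> as ranks. The prime
  \<open>q\<close> divides \<open>a \<le> p + 1\<close>, so \<open>q = p + 1\<close>, which forces
  \<open>p = 2\<close> and \<open>q = 3\<close>. Then \<open>n = 3 * 2 ^ Suc i\<close> has one
  factor 3, so \<open>n = 3 * b\<close> with \<open>b \<le> 4\<close>.\<close>

lemma two_prime_power_bound:
  fixes p q a b i j n :: nat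
  assumes "prime p" "prime q" "p < q" "n = a * p ^ Suc i" "n = b * q ^ Suc j"
    and "0 < a" "a \<le> p + 1" "b \<le> q + 1"
  shows "n \<le> 12"
proof -
  have "q dvd a * p ^ Suc i" using assms(4,5) by (metis dvd_triv_left dvd_mult power_Suc)
  moreover have "\<not> q dvd p ^ Suc i"
    using assms(1,2,3) by (metis less_irrefl prime_dvd_power primes_dvd_imp_eq)
  ultimately have "q dvd a" using assms(2) prime_dvd_multD by blast
  then have a: "a = q" "q = p + 1" using assms(3,6,7) dvd_imp_le[of q a] by auto
  have "p = 2"
  proof (rule ccontr)
    assume "p \<noteq> 2"
    then have "odd p" "odd q" using assms(1,2,3) primes_dvd_imp_eq two_is_prime_nat prime_ge_2_nat
      by (blast, metis less_le_not_le primes_dvd_imp_eq two_is_prime_nat prime_ge_2_nat)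
    then show False using a(2) by simp
  qed
  then have n: "n = 3 * 2 ^ Suc i" "n = b * 3 ^ Suc j" "b \<le> 4" using assms a by simp_all
  have "j = 0"
  proof (rule ccontr)
    assume "j \<noteq> 0"
    then obtain l where "j = Suc l" using not0_implies_Suc by blast
    then have "2 ^ Suc i = 3 * (b * 3 ^ l)" using n by simp
    then have "(3::nat) dvd 2 ^ Suc i" by simp
    then have "(3::nat) dvd 2"
      using prime_dvd_power[OF assms(2), of 2 "Suc i"] a \<open>p = 2\<close> by simp
    then show False by simp
  qed
  then show ?thesis using n by simp
qed

text \<open>The condition \<open>n > 12\<close> takes care of the small primes: since the rank is at
  most \<open>p + 1\<close>, it forces \<open>j \<ge> 2\<close> for \<open>p = 2\<close> and
  \<open>j \<ge> 1\<close> for \<open>p = 3\<close>. That leaves enough doublings or triplings of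
  the index to reach 8 or 9.\<close>

lemma multiplicity_dickson_rank_prime_power:
  assumes "t \<ge> 3" "prime p" "n = dickson_rank t p * p ^ Suc j" "n > 12"
  shows "multiplicity (int p) (dickson t n - 2) = multiplicity (int p) (dickson t (n div p) - 2) + 2"
proof -
  define r where "r = dickson_rank t p"
  obtain m0 where m0: "m0 > 0" "int p dvd dickson t m0 - 2"
    using dickson_rank_le(1)[OF assms(1,2)] by blast
  have r: "r > 0" "int p dvd dickson t m - 2 \<longleftrightarrow> r dvd m" for m
    using dickson_rank_dvd_iff[OF assms(1,2) m0] by (auto simp: r_def)
  have rp: "r \<le> p + 1" using dickson_rank_le(2)[OF assms(1,2)] by (simp add: r_def)
  define m where "m = r * p ^ j"
  have p0: "p > 0" using assms(2) by (rule prime_gt_0_nat)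
  have n: "n = m * p" using assms(3) by (simp add: m_def r_def)
  have m: "m > 0" "n div p = m" using r(1) p0 by (simp_all add: m_def n)
  have "multiplicity (int p) (dickson t (m * p) - 2) = multiplicity (int p) (dickson t m - 2) + 2"
  proof (rule multiplicity_dickson_mult_prime[OF assms(1,2) m(1)])
    show "int p dvd dickson t m - 2" by (simp add: r(2) m_def)
    assume p: "p = 2"
    have "j \<ge> 2"
    proof (rule ccontr)
      assume "\<not> j \<ge> 2"
      then have "(2::nat) ^ j \<le> 2 ^ 1" by (intro power_increasing) auto
      then have "r * 2 ^ j \<le> 3 * 2" using rp p by (intro mult_le_mono) auto
      then show False using assms(4) by (simp add: n m_def p)
    qed
    then obtain l where "j = 2 + l" using le_Suc_ex by blast
    then have "2 * (2 * r) dvd m" by (simp add: m_def p)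
    moreover have "8 dvd dickson t (2 * (2 * r)) - 2"
      using dvd_dickson_double[OF assms(1), of 2 "2 * r"] dvd_dickson_double[OF assms(1), of 1 r] r(2)[of r] p
      by simp
    ultimately show "8 dvd dickson t m - 2"
      using dickson_minus_2_dvd[OF assms(1)] dvd_trans by blast
  next
    assume p: "p = 3"
    have "j \<ge> 1"
    proof (rule ccontr)
      assume "\<not> j \<ge> 1"
      then have "j = 0" by simp
      then show False using assms(4) rp by (simp add: n m_def p)
    qed
    then obtain l where "j = 1 + l" using le_Suc_ex by blast
    then have "3 * r dvd m" by (simp add: m_def p)
    moreover have "9 dvd dickson t (3 * r) - 2"
      using dvd_dickson_triple[OF assms(1), of r] r(2)[of r] p by simp
    ultimately show "9 dvd dickson t m - 2"
      using dickson_minus_2_dvd[OF assms(1)] dvd_trans by blast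
  qed
  then show ?thesis by (simp add: m(2) n[symmetric])
qed

lemma prime_power_or_other_prime:
  fixes k p :: nat
  assumes "prime p" "k > 1"
  obtains j where "k = p ^ Suc j" | q where "prime q" "q \<noteq> p" "q dvd k"
proof -
  obtain m where m: "k = p ^ multiplicity p k * m" "\<not> p dvd m"
    using assms multiplicity_decompose'[of k p] by (metis not_prime_unit not_less_zero)
  show ?thesis
  proof (cases "m = 1")
    case True
    then have "multiplicity p k \<noteq> 0" using m(1) assms(2) by (metis less_irrefl mult_1 power_0)
    then show ?thesis using that(1) m(1) True by (metis mult.right_neutral not0_implies_Suc)
  next
    case False
    then obtain q where "prime q" "q dvd m" using prime_factor_nat by blast
    then show ?thesis using that(2) m by (metis dvd_mult)
  qed
qed

section \<open>Existence of primitive prime divisors\<close>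

lemma totient_ge_6:
  assumes "n > 12"
  shows "totient n \<ge> 6"
proof (rule ccontr)
  assume "\<not> 6 \<le> totient n"
  \<comment> \<open>The totient is monotone along divisibility, so no \<open>d\<close> of totient at
    least 6 divides \<open>n\<close>. Excluding 16, 9, 25, 15, 20, 24 and all primes from 7 on
    leaves only numbers up to 12.\<close>
  then have small: "\<not> d dvd n" if "totient d \<ge> 6" for d
    using totient_dvd_mono[of d n] that assms by fastforce
  have prime: "prime (3::nat)" "prime (5::nat)" by simp_all
  have "totient (2 ^ 4) = 8" "totient (3 ^ 2) = 6" "totient (5 ^ 2) = 20" "totient (2 ^ 3) = 4"
    by (subst totient_prime_power; simp add: prime)+
  moreover have "totient 3 = 2" "totient 5 = 4" by (simp_all add: totient_prime prime)
  moreover have "coprime (3::nat) 5" "coprime (2::nat) 5" "coprime (2::nat) 3"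
    by (simp_all add: primes_coprime prime)
  then have "totient (3 * 5) = totient 3 * totient 5" "totient (2\<^sup>2 * 5) = totient (2\<^sup>2) * totient 5"
      "totient (2 ^ 3 * 3) = totient (2 ^ 3) * totient 3"
    by (simp_all only: totient_mult_coprime coprime_power_left_iff simp_thms)
  ultimately have "totient 16 = 8" "totient 9 = 6" "totient 25 = 20" "totient 15 = 8" "totient 20 = 8" "totient 24 = 8"
    by simp_all
  then have nd: "\<not> 2 ^ 4 dvd n" "\<not> 3 ^ 2 dvd n" "\<not> 5 ^ 2 dvd n" "\<not> 15 dvd n" "\<not> 20 dvd n" "\<not> 24 dvd n"
    using small by simp_all
  have sub: "prime_factors n \<subseteq> {2, 3, 5}"
  proof
    fix p assume p: "p \<in> prime_factors n"
    then have "prime p" "p dvd n" by auto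
    then have "p < 7" using small[of p] totient_prime[of p] by force
    moreover have "\<not> prime (4::nat)" "\<not> prime (6::nat)" by simp_all
    moreover have "p \<ge> 2" using \<open>prime p\<close> by (rule prime_ge_2_nat)
    ultimately show "p \<in> {2, 3, 5}" using \<open>prime p\<close>
      by (cases "p = 2 \<or> p = 3 \<or> p = 4 \<or> p = 5 \<or> p = 6") auto
  qed
  define a b c where "a = multiplicity 2 n" and "b = multiplicity 3 n" and "c = multiplicity 5 n"
  have "n = (\<Prod>p\<in>prime_factors n. p ^ multiplicity p n)"
    using assms by (intro prime_factorization_nat) auto
  also have "\<dots> = (\<Prod>p\<in>{2, 3, 5}. p ^ multiplicity p n)"
    using sub by (intro prod.mono_neutral_left) (auto simp: prime_factors_multiplicity)
  finally have n: "n = 2 ^ a * (3 ^ b * 5 ^ c)" by (simp add: a_def b_def c_def)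
  have "a < 4" "b < 2" "c < 2"
    using nd(1,2,3) n le_imp_power_dvd[of 4 a "2::nat"] le_imp_power_dvd[of 2 b "3::nat"]
      le_imp_power_dvd[of 2 c "5::nat"]
    by (metis dvd_mult dvd_mult2 not_le)+
  then have "a \<in> {0, 1, 2, 3}" "b \<in> {0, 1}" "c \<in> {0, 1}" by auto
  with n nd(4-6) assms show False by auto
qed

text \<open>\<open>1 - x - x^2\<close> is the start of Euler's pentagonal series; the extra term
  \<open>x ^ Suc n\<close> makes the induction close.\<close>

lemma prod_one_minus_power_ge:
  fixes x :: real
  assumes "0 \<le> x" "x \<le> 1" "n > 0"
  shows "(\<Prod>d=1..n. 1 - x ^ d) \<ge> 1 - x - x\<^sup>2 + x ^ Suc n"
  using \<open>n > 0\<close>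
proof (induction n rule: nat_induct_non_zero)
  case (Suc n)
  define y where "y = x ^ Suc n"
  have y: "0 \<le> y" "y \<le> 1" "y \<le> x\<^sup>2"
    using assms Suc.hyps power_decreasing[of 2 "Suc n" x] by (auto simp: y_def power_le_one simp del: power_Suc)
  have "(1 - x - x\<^sup>2 + y) * (1 - y) \<le> (\<Prod>d=1..n. 1 - x ^ d) * (1 - y)"
    using Suc.IH y by (intro mult_right_mono) (auto simp: y_def)
  moreover have "y * (x\<^sup>2 - y) \<ge> 0" using y by simp
  then have "1 - x - x\<^sup>2 + x * y \<le> (1 - x - x\<^sup>2 + y) * (1 - y)"
    by (simp add: algebra_simps power2_eq_square)
  ultimately show ?case by (simp add: y_def)
qed (simp add: power2_eq_square)

text \<open>For \<open>totient n = 2 * m\<close> this is the square root of the comparison needed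
  below. It is tight at the start: about 7.73 against 7 at \<open>m = 3\<close>.\<close>

lemma power_dominates:
  assumes "m \<ge> 3"
  shows "0.44 * 2.6 ^ m > real (2 * m + 1)"
  using assms
proof (induction m rule: nat_induct_at_least)
  case (Suc m)
  then have "real (2 * Suc m + 1) \<le> 2.6 * real (2 * m + 1)" by simp
  also have "\<dots> < 2.6 * (0.44 * 2.6 ^ m)" using Suc by (intro mult_strict_left_mono) auto
  finally show ?case by simp
qed (simp add: eval_nat_numeral)

text \<open>From \<open>W d = g ^ d * (1 - x ^ d)^2\<close> with \<open>x = 1 / g\<close>, the first
  factor contributes exactly \<open>totient n * ln g\<close>, and the second at least
  \<open>2 * ln 0.44\<close>.\<close>

lemma mobius_sum_ln_dickson_lower:
  assumes "t \<ge> 3" "n > 12"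
  shows "mobius_sum n (\<lambda>d. ln (real_of_int (dickson t d - 2))) > 2 * ln (real (totient n + 1))"
proof -
  obtain g :: real where g: "g \<ge> 2.6" "of_int t = g + 1 / g"
    using dickson_root[OF assms(1)] .
  define x where "x = 1 / g"
  have x: "0 < x" "x \<le> 1 / 2.6" using g(1) by (simp_all add: x_def field_simps)
  then have x1: "x < 1" by simp
  have xd: "0 < 1 - x ^ d \<and> 1 - x ^ d \<le> 1" if "d > 0" for d
  proof -
    have "x ^ d \<le> x ^ 1" using x x1 that by (intro power_decreasing) auto
    then show ?thesis using x(1) x1 by simp
  qed
  have ln_w: "ln (real_of_int (dickson t d - 2)) = ln g * real d + 2 * ln (1 - x ^ d)" if "d > 0" for d
  proof -
    have "g ^ d * x ^ d = 1" using g(1) by (simp add: x_def flip: power_mult_distrib)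
    then have "g ^ d + x ^ d - 2 = g ^ d * (1 - x ^ d)\<^sup>2"
      by (simp add: power2_eq_square algebra_simps)
    then have "real_of_int (dickson t d - 2) = g ^ d * (1 - x ^ d)\<^sup>2"
      using of_int_dickson[OF _ g(2), of d] g(1) by (simp add: x_def)
    also have "ln \<dots> = ln g * real d + 2 * ln (1 - x ^ d)"
      using xd[OF that] g(1) by (simp add: ln_mult ln_realpow)
    finally show ?thesis .
  qed
  have div_pos: "n div \<Prod>S > 0" if "S \<in> Pow (prime_factors n)" for S
  proof -
    have "\<Prod>S dvd n" using that by (intro prod_primes_dvd_subset) auto
    then show ?thesis using assms(2) by (metis dvd_mult_div_cancel gr0I mult_0_right not_less_zero)
  qed
  have "mobius_sum n (\<lambda>d. ln (real_of_int (dickson t d - 2)))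
      = mobius_sum n (\<lambda>d. ln g * real d + 2 * ln (1 - x ^ d))"
    unfolding mobius_sum_def using div_pos ln_w by (intro sum.cong) auto
  also have "\<dots> = ln g * mobius_sum n real + 2 * mobius_sum n (\<lambda>d. ln (1 - x ^ d))"
    by (simp add: mobius_sum_def sum_distrib_left sum.distrib algebra_simps)
  finally have eq: "mobius_sum n (\<lambda>d. ln (real_of_int (dickson t d - 2)))
      = ln g * real (totient n) + 2 * mobius_sum n (\<lambda>d. ln (1 - x ^ d))"
    by (simp add: mobius_sum_of_nat)
  \<comment> \<open>At \<open>x = 1 / 2.6\<close> the value of \<open>1 - x - x^2\<close> is about
    0.467.\<close>
  have "ln (0.44 :: real) \<le> ln (\<Prod>d=1..n. 1 - x ^ d)"
  proof -
    have "x\<^sup>2 \<le> (1 / 2.6)\<^sup>2" using x by (intro power_mono) auto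
    then have "0.44 \<le> 1 - x - x\<^sup>2" using x(2) by (simp add: power2_eq_square)
    also have "\<dots> \<le> 1 - x - x\<^sup>2 + x ^ Suc n" using x(1) by simp
    also have "\<dots> \<le> (\<Prod>d=1..n. 1 - x ^ d)"
      using x x1 assms(2) by (intro prod_one_minus_power_ge) auto
    finally show ?thesis by (rule ln_mono) simp
  qed
  also have "\<dots> = (\<Sum>d=1..n. ln (1 - x ^ d))"
  proof (rule ln_prod)
    fix d assume "d \<in> {1..n}"
    then show "1 - x ^ d \<noteq> 0" using xd[of d] by simp
  qed simp
  also have "\<dots> \<le> mobius_sum n (\<lambda>d. ln (1 - x ^ d))"
    using assms(2) xd by (intro mobius_sum_ge) auto
  finally have lower: "ln 0.44 \<le> mobius_sum n (\<lambda>d. ln (1 - x ^ d))" .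
  have "even (totient n)" using assms(2) by (intro totient_even) simp
  then obtain m where m: "totient n = 2 * m" by (elim evenE)
  have m3: "m \<ge> 3" using totient_ge_6[OF assms(2)] m by simp
  have "real (2 * m + 1) < 0.44 * 2.6 ^ m" using power_dominates[OF m3] .
  also have "\<dots> \<le> 0.44 * g ^ m" using g(1) by (intro mult_left_mono power_mono) auto
  finally have "ln (real (2 * m + 1)) < ln (0.44 * g ^ m)" by simp
  also have "\<dots> = ln 0.44 + m * ln g" using g(1) by (subst ln_mult) (auto simp: ln_realpow)
  finally show ?thesis using lower unfolding eq m by (simp add: algebra_simps)
qed

text \<open>The sum is decomposed over the primes of \<open>W n\<close>, which include those of
  every \<open>W d\<close> with \<open>d dvd n\<close>; the \<open>c q\<close> are the resulting
  exponents.\<close>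

lemma mobius_sum_ln_dickson_upper:
  assumes "t \<ge> 3" "n > 12"
    and no: "\<And>p. prime p \<Longrightarrow> int p dvd dickson t n - 2 \<Longrightarrow> \<exists>m. 1 \<le> m \<and> m < n \<and> int p dvd dickson t m - 2"
  shows "mobius_sum n (\<lambda>d. ln (real_of_int (dickson t d - 2))) \<le> 2 * ln (real (totient n + 1))"
proof -
  define Q where "Q = prime_factors (dickson t n - 2)"
  define c where "c q = mobius_sum n (\<lambda>d. real (multiplicity q (dickson t d - 2)))" for q
  have pos: "dickson t d - 2 > 0" if "d > 0" for d using dickson_ge_3[OF assms(1) that] by simp
  have ln_w: "ln (real_of_int (dickson t d - 2)) = (\<Sum>q\<in>Q. ln (real_of_int q) * real (multiplicity q (dickson t d - 2)))"
    if "d > 0" "d dvd n" for d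
  proof -
    have w: "dickson t d - 2 \<noteq> 0" "dickson t n - 2 \<noteq> 0" using pos[of d] pos[of n] that assms(2) by auto
    have prime: "prime q" if "q \<in> Q" for q using that by (auto simp: Q_def)
    have "dickson t d - 2 = (\<Prod>q\<in>prime_factors (dickson t d - 2). q ^ multiplicity q (dickson t d - 2))"
      using prod_prime_factors[OF w(1)] pos[OF that(1)] by simp
    also have "\<dots> = (\<Prod>q\<in>Q. q ^ multiplicity q (dickson t d - 2))"
    proof (rule prod.mono_neutral_left)
      show "prime_factors (dickson t d - 2) \<subseteq> Q"
        unfolding Q_def using dvd_prime_factors[OF w(2) dickson_minus_2_dvd[OF assms(1) that(2)]] .
      show "\<forall>q\<in>Q - prime_factors (dickson t d - 2). q ^ multiplicity q (dickson t d - 2) = 1"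
        using prime by (simp add: prime_factors_multiplicity)
    qed (simp add: Q_def)
    finally have "real_of_int (dickson t d - 2) = (\<Prod>q\<in>Q. real_of_int q ^ multiplicity q (dickson t d - 2))"
      by (metis (no_types, lifting) of_int_prod of_int_power prod.cong)
    also have "ln \<dots> = (\<Sum>q\<in>Q. ln (real_of_int q ^ multiplicity q (dickson t d - 2)))"
    proof (rule ln_prod)
      show "real_of_int q ^ multiplicity q (dickson t d - 2) \<noteq> 0" if "q \<in> Q" for q
        using prime_gt_0_int[OF prime[OF that]] by simp
    qed (simp add: Q_def)
    also have "\<dots> = (\<Sum>q\<in>Q. ln (real_of_int q) * real (multiplicity q (dickson t d - 2)))"
      using prime by (intro sum.cong) (auto simp: ln_realpow prime_gt_0_int)
    finally show ?thesis .
  qed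
  have "mobius_sum n (\<lambda>d. ln (real_of_int (dickson t d - 2)))
      = mobius_sum n (\<lambda>d. \<Sum>q\<in>Q. ln (real_of_int q) * real (multiplicity q (dickson t d - 2)))"
    unfolding mobius_sum_def
  proof (intro sum.cong refl arg_cong[of _ _ "(*) _"] ln_w)
    fix S assume "S \<in> Pow (prime_factors n)"
    then have "\<Prod>S dvd n" by (intro prod_primes_dvd_subset) auto
    then show "n div \<Prod>S dvd n" by (metis dvd_div_mult_self dvd_triv_left)
    with assms(2) show "n div \<Prod>S > 0" by (auto intro: gr0I)
  qed
  also have "\<dots> = (\<Sum>q\<in>Q. ln (real_of_int q) * c q)"
    by (simp add: mobius_sum_lincomb c_def)
  finally have eq: "mobius_sum n (\<lambda>d. ln (real_of_int (dickson t d - 2))) = (\<Sum>q\<in>Q. ln (real_of_int q) * c q)" .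
  \<comment> \<open>These are the only primes with nonzero exponent;
    \<open>two_prime_power_bound\<close> leaves at most one of them.\<close>
  define B where "B = {q \<in> Q. \<exists>j. n = dickson_rank t (nat q) * nat q ^ Suc j}"
  have Q: "c q = (if q \<in> B then 2 else 0)" "prime (nat q)" "int (nat q) = q"
    "0 < dickson_rank t (nat q)" "dickson_rank t (nat q) \<le> nat q + 1" if "q \<in> Q" for q
  proof -
    define p where "p = nat q"
    define r where "r = dickson_rank t p"
    have "prime q" "q dvd dickson t n - 2" using that by (auto simp: Q_def)
    have q: "q = int p" using prime_ge_0_int[OF \<open>prime q\<close>] by (simp add: p_def)
    have p: "prime p" using \<open>prime q\<close> unfolding q by simp
    have pn: "int p dvd dickson t n - 2" using \<open>q dvd dickson t n - 2\<close> q by simp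
    have r: "0 < r" "int p dvd dickson t m - 2 \<longleftrightarrow> r dvd m" for m
      using dickson_rank_dvd_iff[OF assms(1) p _ pn] assms(2) by (auto simp: r_def)
    show "prime (nat q)" "int (nat q) = q" "0 < dickson_rank t (nat q)" "dickson_rank t (nat q) \<le> nat q + 1"
      using q p r(1) dickson_rank_le(2)[OF assms(1) p] by (simp_all add: p_def[symmetric] r_def[symmetric])
    have rn: "r dvd n" using r(2) pn by simp
    obtain m where m: "1 \<le> m" "m < n" "r dvd m" using no[OF p pn] r(2) by blast
    then have "r < n" using dvd_imp_le[of r m] by simp
    obtain k where k: "n = r * k" using rn by (elim dvdE)
    \<comment> \<open>Here the absence of primitive primes enters: \<open>k = 1\<close> would mean
      that \<open>n\<close> itself is the rank of \<open>p\<close>.\<close>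
    then have "k > 1" using \<open>r < n\<close> by (cases "k = 0"; cases "k = 1") auto
    show "c q = (if q \<in> B then 2 else 0)"
    proof (cases "q \<in> B")
      case True
      then obtain j where j: "n = dickson_rank t p * p ^ Suc j" by (auto simp: B_def p_def)
      show ?thesis
        using mobius_sum_multiplicity_prime_power[OF assms(1) p j]
          multiplicity_dickson_rank_prime_power[OF assms(1) p j assms(2)] True
        by (simp add: c_def q)
    next
      case False
      have "k \<noteq> p ^ Suc j" for j
        using False that k unfolding B_def p_def r_def by blast
      then obtain l where l: "prime l" "l \<noteq> p" "l dvd k"
        using prime_power_or_other_prime[OF p \<open>k > 1\<close>] by metis
      have "n div dickson_rank t p = k" using k r(1) by (simp add: r_def)
      then show ?thesis
        using mobius_sum_multiplicity_eq_0[OF assms(1) p _ _ l(1,2)] l(3) rn assms(2) False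
        by (simp add: c_def q r_def)
    qed
  qed
  have BQ: "B \<subseteq> Q" "finite Q" by (auto simp: B_def Q_def)
  have uniq: "q = q'" if "q \<in> B" "q' \<in> B" for q q'
  proof (rule ccontr)
    assume ne: "q \<noteq> q'"
    have False if qq: "q \<in> B" "q' \<in> B" "nat q < nat q'" for q q'
    proof -
      obtain i where i: "n = dickson_rank t (nat q) * nat q ^ Suc i"
        using qq(1) unfolding B_def by blast
      obtain j where j: "n = dickson_rank t (nat q') * nat q' ^ Suc j"
        using qq(2) unfolding B_def by blast
      have "q \<in> Q" "q' \<in> Q" using qq BQ(1) by auto
      then have "n \<le> 12"
        by (intro two_prime_power_bound[OF _ _ qq(3) i j] Q)
      then show False using assms(2) by simp
    qed
    moreover have "nat q \<noteq> nat q'"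
      using ne Q(3)[of q] Q(3)[of q'] subsetD[OF BQ(1)] that by metis
    ultimately show False using that by (meson linorder_neqE_nat)
  qed
  have "(\<Sum>q\<in>Q. ln (real_of_int q) * c q) = (\<Sum>q\<in>B. ln (real_of_int q) * 2)"
    using BQ Q(1) by (intro sum.mono_neutral_cong_right) auto
  also have "\<dots> \<le> 2 * ln (real (totient n + 1))"
  proof (cases "B = {}")
    case True
    have "0 \<le> ln (real (totient n + 1))" by (rule ln_ge_zero) simp
    with True show ?thesis by simp
  next
    case False
    then obtain q where q: "q \<in> B" by blast
    then have "B = {q}" using uniq by blast
    have p: "prime (nat q)" using q Q(2)[of q] BQ(1) by auto
    have "nat q dvd n" using q by (auto simp: B_def)
    then have "totient (nat q) \<le> totient n" using assms(2) by (intro totient_dvd_mono) auto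
    then have "nat q \<le> totient n + 1" using p by (simp add: totient_prime)
    moreover have "real_of_int q = real (nat q)" using Q(3)[of q] q BQ by (metis of_int_of_nat_eq subsetD)
    ultimately have "ln (real_of_int q) \<le> ln (real (totient n + 1))"
      using prime_gt_0_nat[OF p] by (subst ln_le_cancel_iff) auto
    then show ?thesis by (simp add: \<open>B = {q}\<close>)
  qed
  finally show ?thesis by (simp only: eq)
qed

theorem dickson_primitive_prime:
  assumes "t \<ge> 3" "n > 12"
  obtains p where "prime p" "int p dvd dickson t n - 2"
    "\<And>m. 1 \<le> m \<Longrightarrow> m < n \<Longrightarrow> \<not> int p dvd dickson t m - 2"
  using mobius_sum_ln_dickson_upper[OF assms] mobius_sum_ln_dickson_lower[OF assms]
  by (meson not_le)

section \<open>Lehmer-Pierce sequences\<close>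

lemma power_plus_power_int:
  fixes a b :: real
  assumes "a + b = of_int s" "a * b = of_int c"
  shows "\<exists>k. a ^ n + b ^ n = of_int k"
proof (induction n rule: induct_nat_012)
  case (ge2 n)
  then obtain k l where kl: "a ^ n + b ^ n = of_int k" "a ^ Suc n + b ^ Suc n = of_int l" by blast
  have "a ^ Suc (Suc n) + b ^ Suc (Suc n) = (a + b) * (a ^ Suc n + b ^ Suc n) - a * b * (a ^ n + b ^ n)"
    by (simp add: algebra_simps)
  also have "\<dots> = of_int (s * l - c * k)" unfolding kl assms by simp
  finally show ?case by blast
qed (use assms in \<open>auto intro: exI[of _ 2] exI[of _ s]\<close>)

lemma algebraic_unit_irrational:
  fixes x y :: real
  assumes "algebraic_int x" "algebraic_int y" "x * y = 1" "x > 0" "x \<noteq> 1"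
  shows "x \<notin> \<rat>"
proof
  assume rat: "x \<in> \<rat>"
  then have "x \<in> \<int>" using assms(1) by (intro rational_algebraic_int_is_int)
  then obtain k where k: "x = of_int k" by (elim Ints_cases)
  have "y = inverse x" using assms(3) by (metis inverse_unique)
  then have "y \<in> \<int>" using rat assms(2) by (intro rational_algebraic_int_is_int) auto
  then obtain l where l: "y = of_int l" by (elim Ints_cases)
  have "k * l = 1" using assms(3) unfolding k l by (simp flip: of_int_mult)
  moreover have "k > 0" using assms(4) k by simp
  ultimately have "k = 1" by (simp add: zmult_eq_1_iff)
  then show False using assms(5) k by simp
qed

text \<open>A rational \<open>a ^ n\<close> would be an integer dividing \<open>c ^ n\<close>, so it
  would be 1 by positivity. Irrationality is what lets \<open>rat_quadratic_unique\<close> read the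
  norm off a quadratic equation.\<close>

lemma power_conjugate_irrational:
  fixes a b :: real
  assumes "a + b = of_int s" "a * b = of_int c" "\<bar>c\<bar> = 1" "a > 0" "a \<noteq> 1" "n > 0"
  shows "a ^ n \<notin> \<rat>"
proof
  assume rat: "a ^ n \<in> \<rat>"
  obtain k where k: "a ^ n + b ^ n = of_int k" using power_plus_power_int[OF assms(1,2)] by blast
  have "a ^ n * b ^ n = of_int (c ^ n)" using assms(2) by (simp flip: power_mult_distrib)
  moreover have "b ^ n = of_int k - a ^ n" using k by simp
  ultimately have eq: "a ^ n * (of_int k - a ^ n) = of_int (c ^ n)" by simp
  \<comment> \<open>The monic quadratic with roots \<open>a ^ n\<close> and
    \<open>b ^ n\<close>.\<close>
  have "poly (map_poly of_int [:c ^ n, - k, 1:]) (a ^ n) = 0"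
    using eq by (simp add: map_poly_pCons algebra_simps)
  then have "algebraic_int (a ^ n)"
    unfolding algebraic_int_altdef_ipoly by (intro exI[of _ "[:c ^ n, - k, 1:]"]) simp
  then have "a ^ n \<in> \<int>" using rat by (rule rational_algebraic_int_is_int)
  then obtain z where z: "a ^ n = of_int z" by (elim Ints_cases)
  have "z * (k - z) = c ^ n" using eq unfolding z by (simp only: of_int_eq_iff flip: of_int_diff of_int_mult)
  then have "z dvd c ^ n" by (metis dvd_triv_left)
  moreover have "\<bar>c ^ n\<bar> = 1" using assms(3) by (simp add: power_abs)
  ultimately have "z dvd 1" by (metis dvd_abs_iff)
  moreover have "z > 0" using assms(4) z by (metis of_int_0_less_iff zero_less_power)
  ultimately have "a ^ n = 1 ^ n" using z by simp
  then show False using assms(4-6) power_eq_imp_eq_base[of a n 1] by simp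
qed

lemma real_quadratic_field_closed:
  assumes "real_quadratic_field K" "x \<in> K"
  shows "x ^ n - 1 \<in> K"
proof -
  have "x ^ n \<in> K"
    using assms by (induction n) (auto simp: real_quadratic_field_def real_subfield_def)
  then have "x ^ n + - 1 \<in> K"
    using assms(1) unfolding real_quadratic_field_def real_subfield_def by blast
  then show ?thesis by simp
qed

text \<open>\<open>of_int c / \<alpha>\<close> is the conjugate of \<open>\<alpha>\<close>, since
  their product is the norm. The norm of \<open>\<alpha> ^ n - 1\<close> is found by exhibiting the
  rational quadratic satisfied by it and its conjugate.\<close>

lemma unit_conjugate:
  fixes \<alpha> :: real
  assumes K: "real_quadratic_field K" and \<alpha>: "\<alpha> \<in> ring_of_integers K"
    and \<beta>: "\<beta> \<in> ring_of_integers K" "\<alpha> * \<beta> = 1"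
    and pos: "\<alpha> > 0" "\<alpha> \<noteq> 1" and c: "field_norm K \<alpha> = of_int c" "\<bar>c\<bar> = 1"
  shows "\<exists>s. \<alpha> + of_int c / \<alpha> = of_int s"
    and "n > 0 \<Longrightarrow> of_int (lehmer_pierce K \<alpha> n) = (\<alpha> ^ n - 1) * ((of_int c / \<alpha>) ^ n - 1)"
proof -
  have \<alpha>K: "\<alpha> \<in> K" "algebraic_int \<alpha>" "algebraic_int \<beta>"
    using \<alpha> \<beta> by (auto simp: ring_of_integers_def)
  obtain t where t: "\<alpha>\<^sup>2 - of_rat t * \<alpha> + of_rat (field_norm K \<alpha>) = 0"
    using field_norm_quadratic[OF K \<alpha>K(1)] .
  have "t \<in> \<int>" using algebraic_int_quadratic(1)[OF \<alpha>K(2) _ t]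
      algebraic_unit_irrational[OF \<alpha>K(2,3) \<beta>(2) pos] by simp
  then obtain s where s: "t = of_int s" by (elim Ints_cases)
  have "\<alpha>\<^sup>2 + of_int c = of_int s * \<alpha>" using t by (simp add: s c)
  then have sum: "\<alpha> + of_int c / \<alpha> = of_int s" using pos by (simp add: field_simps power2_eq_square)
  then show "\<exists>s. \<alpha> + of_int c / \<alpha> = of_int s" by blast
  assume n: "n > 0"
  define b where "b = of_int c / \<alpha>"
  have ab: "\<alpha> * b = of_int c" using pos by (simp add: b_def)
  obtain k where k: "\<alpha> ^ n + b ^ n = of_int k"
    using power_plus_power_int[OF sum[folded b_def] ab] by blast
  have abn: "\<alpha> ^ n * b ^ n = of_int (c ^ n)" using ab by (simp flip: power_mult_distrib)
  define y where "y = \<alpha> ^ n - 1"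
  have y: "y \<in> K" unfolding y_def using K \<alpha>K(1) by (rule real_quadratic_field_closed)
  have y_irr: "y \<notin> \<rat>"
  proof
    assume "y \<in> \<rat>"
    then have "y + 1 \<in> \<rat>" by simp
    then show False
      using power_conjugate_irrational[OF sum[folded b_def] ab c(2) pos n] by (simp add: y_def)
  qed
  obtain u where u: "y\<^sup>2 - of_rat u * y + of_rat (field_norm K y) = 0"
    using field_norm_quadratic[OF K y] .
  have prod: "y * (b ^ n - 1) = of_int (c ^ n - k + 1)"
  proof -
    have "y * (b ^ n - 1) = \<alpha> ^ n * b ^ n - (\<alpha> ^ n + b ^ n) + 1" by (simp add: y_def algebra_simps)
    then show ?thesis unfolding abn k by simp
  qed
  \<comment> \<open>The monic quadratic with roots \<open>y\<close> and
    \<open>b ^ n - 1\<close>.\<close>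
  have "y\<^sup>2 - (\<alpha> ^ n + b ^ n - 2) * y + y * (b ^ n - 1) = 0"
    by (simp add: y_def power2_eq_square algebra_simps)
  then have "y\<^sup>2 - of_rat (of_int (k - 2)) * y + of_rat (of_int (c ^ n - k + 1)) = 0"
    unfolding prod k of_rat_of_int_eq by simp
  from rat_quadratic_unique(2)[OF y_irr u this]
  have "field_norm K (\<alpha> ^ n - 1) = of_int (c ^ n - k + 1)" by (simp add: y_def)
  then have "(of_int (lehmer_pierce K \<alpha> n) :: rat) = of_int (c ^ n - k + 1)"
    using of_int_lehmer_pierce[OF K \<alpha>, of n] by simp
  then have "lehmer_pierce K \<alpha> n = c ^ n - k + 1" by (simp only: of_int_eq_iff)
  then show "of_int (lehmer_pierce K \<alpha> n) = (\<alpha> ^ n - 1) * ((of_int c / \<alpha>) ^ n - 1)"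
    using prod by (simp add: y_def b_def)
qed

lemma plus_inverse_gt_2:
  fixes x :: real
  assumes "x > 0" "x \<noteq> 1"
  shows "x + 1 / x > 2"
proof -
  have "(x - 1)\<^sup>2 / x > 0" using assms by simp
  moreover have "(x - 1)\<^sup>2 / x = x + 1 / x - 2" using assms(1) by (simp add: field_simps power2_eq_square)
  ultimately show ?thesis by simp
qed

theorem theorem1p4:
  fixes K :: "real set" and \<alpha> :: real
  assumes "real_quadratic_field K"
    and "\<alpha> \<in> ring_of_integers K"
    and "\<exists>\<beta>\<in>ring_of_integers K. \<alpha> * \<beta> = 1"
    and "\<alpha> \<noteq> 1" and "\<alpha> \<noteq> -1" and "\<alpha> > 0"
  shows "(field_norm K \<alpha> = 1 \<longrightarrow>
           (\<forall>n>12. \<exists>p. primitive_prime_divisor (lehmer_pierce K \<alpha>) n p)) \<and>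
         (field_norm K \<alpha> = -1 \<longrightarrow>
           (\<forall>n>24. (\<not> (\<exists>p. primitive_prime_divisor (lehmer_pierce K \<alpha>) n p))
                     \<longleftrightarrow> [n = 2] (mod 4)))"
proof -
  define L where "L = lehmer_pierce K \<alpha>"
  obtain \<beta> where \<beta>: "\<beta> \<in> ring_of_integers K" "\<alpha> * \<beta> = 1" using assms(3) by blast
  note conj = unit_conjugate[OF assms(1,2) \<beta> assms(6,4)]
  have norm_1: "\<exists>p. primitive_prime_divisor L n p" if c: "field_norm K \<alpha> = 1" and n: "n > 12" for n
  proof -
    obtain t where t: "\<alpha> + 1 / \<alpha> = of_int t" using conj(1)[of 1] c by auto
    have t3: "t \<ge> 3" using plus_inverse_gt_2[OF assms(6,4)] t by simp
    have L: "L m = - (dickson t m - 2)" if "m > 0" for m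
    proof -
      have "real_of_int (L m) = (\<alpha> ^ m - 1) * ((1 / \<alpha>) ^ m - 1)"
        using conj(2)[of 1 m] c that by (simp add: L_def)
      also have "\<dots> = - (\<alpha> ^ m + (1 / \<alpha>) ^ m - 2)"
        using assms(6) by (simp add: field_simps power_one_over)
      also have "\<dots> = of_int (- (dickson t m - 2))"
        using of_int_dickson[of \<alpha> t m] t assms(6) by simp
      finally show ?thesis by (simp only: of_int_eq_iff)
    qed
    obtain p where p: "prime p" "int p dvd dickson t n - 2"
        "\<And>m. 1 \<le> m \<Longrightarrow> m < n \<Longrightarrow> \<not> int p dvd dickson t m - 2"
      using dickson_primitive_prime[OF t3 n] by blast
    have "primitive_prime_divisor L n p"
      unfolding primitive_prime_divisor_def
    proof (intro conjI allI impI)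
      show "int p dvd L n" unfolding L[OF order.strict_trans[OF _ n, of 0, simplified]]
        using p(2) by (simp only: dvd_minus_iff)
      fix m assume "1 \<le> m \<and> m < n \<and> L m \<noteq> 0"
      then have m: "1 \<le> m" "m < n" by auto
      then have "L m = - (dickson t m - 2)" using L[of m] by simp
      then show "\<not> int p dvd L m" using p(3)[OF m] by (metis dvd_minus_iff)
    qed (fact p(1))
    then show ?thesis by blast
  qed
  have norm_minus_1: "(\<not> (\<exists>p. primitive_prime_divisor L n p)) \<longleftrightarrow> [n = 2] (mod 4)"
    if c: "field_norm K \<alpha> = -1" and n: "n > 24" for n
  proof -
    obtain a where a: "\<alpha> - 1 / \<alpha> = of_int a" using conj(1)[of "-1"] c by auto
    \<comment> \<open>The conjugate of \<open>\<alpha>\<close> is \<open>- 1 / \<alpha>\<close>, so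
      \<open>a\<close> is the trace of \<open>\<alpha>\<close>, and \<open>g\<close> has norm 1 and
      trace \<open>a^2 + 2\<close>.\<close>
    define g where "g = \<alpha>\<^sup>2"
    define t where "t = a\<^sup>2 + 2"
    have g: "g > 0" "g \<noteq> 1" using assms(4,6) by (simp_all add: g_def power2_eq_1_iff)
    have "(\<alpha> - 1 / \<alpha>)\<^sup>2 = g + 1 / g - 2"
      using assms(6) by (simp add: g_def power2_eq_square algebra_simps)
    then have t: "of_int t = g + 1 / g" unfolding a by (simp add: t_def)
    have t3: "t \<ge> 3" using plus_inverse_gt_2[OF g] t by linarith
    have L_real: "real_of_int (L m) = (\<alpha> ^ m - 1) * ((- 1 / \<alpha>) ^ m - 1)" if "m > 0" for m
      using conj(2)[of "-1" m] c that by (simp add: L_def)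
    have dick: "real_of_int (dickson t m - 2) = \<alpha> ^ (2 * m) + (1 / \<alpha>) ^ (2 * m) - 2" for m
      using of_int_dickson[OF _ t, of m] g by (simp add: g_def power_mult power_one_over)
    have even: "L (2 * m) = - (dickson t m - 2)" if "m > 0" for m
    proof -
      have "real_of_int (L (2 * m)) = (\<alpha> ^ (2 * m) - 1) * ((1 / \<alpha>) ^ (2 * m) - 1)"
        using L_real[of "2 * m"] that by (simp add: power_mult)
      also have "\<dots> = - (\<alpha> ^ (2 * m) + (1 / \<alpha>) ^ (2 * m) - 2)"
        using assms(6) by (simp add: field_simps power_one_over)
      also have "\<dots> = of_int (- (dickson t m - 2))" using dick[of m] by simp
      finally show ?thesis by (simp only: of_int_eq_iff)
    qed
    have odd: "(L m)\<^sup>2 = dickson t m - 2" if "odd m" for m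
    proof -
      define u v where "u = \<alpha> ^ m" and "v = (1 / \<alpha>) ^ m"
      have uv: "u * v = 1" using assms(6) by (simp add: u_def v_def flip: power_mult_distrib)
      have "(- 1 / \<alpha>) ^ m = - v"
        using that power_minus_odd[of m "1 / \<alpha>"] by (simp add: v_def)
      then have "real_of_int (L m) = (u - 1) * (- v - 1)"
        using L_real[of m] that by (simp add: u_def odd_pos)
      \<comment> \<open>For odd \<open>m\<close>, \<open>\<alpha> ^ m\<close> has norm -1, so only
        minus its trace survives.\<close>
      also have "\<dots> = v - u" using uv by (simp add: algebra_simps)
      finally have "real_of_int ((L m)\<^sup>2) = (v - u)\<^sup>2" by simp
      also have "\<dots> = u\<^sup>2 + v\<^sup>2 - 2" using uv by (simp add: power2_eq_square algebra_simps)
      also have "\<dots> = of_int (dickson t m - 2)"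
        unfolding dick u_def v_def by (simp add: mult.commute flip: power_mult)
      finally show ?thesis by (simp only: of_int_eq_iff)
    qed
    have dvd_dickson: "int p dvd dickson t m - 2" if "odd m" "int p dvd L m" for m p
      using odd[OF that(1)] that(2) by (metis dvd_mult power2_eq_square)
    \<comment> \<open>Used with \<open>k = n\<close> for odd \<open>n\<close> and
      \<open>k = n div 2\<close> for \<open>n\<close> divisible by 4; then \<open>n > 24\<close>
      gives \<open>k > 12\<close>. A prime of rank \<open>k\<close> misses every even
      \<open>m = 2 * l < n\<close>, as \<open>l < k\<close>; if it divides \<open>L m\<close> for
      odd \<open>m\<close>, then \<open>k\<close> divides \<open>m\<close>, which
      \<open>odd_dvd\<close> rules out below \<open>n\<close>.\<close>
    have primitiveI: "\<exists>p. primitive_prime_divisor L n p"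
      if k: "k > 12" "n = k \<or> n = 2 * k" and pn: "\<And>p. prime p \<Longrightarrow> int p dvd dickson t k - 2 \<Longrightarrow> int p dvd L n"
        and odd_dvd: "\<And>m. odd m \<Longrightarrow> k dvd m \<Longrightarrow> n \<le> m" for k
    proof -
      obtain p where p: "prime p" "int p dvd dickson t k - 2"
          "\<And>m. 1 \<le> m \<Longrightarrow> m < k \<Longrightarrow> \<not> int p dvd dickson t m - 2"
        using dickson_primitive_prime[OF t3 k(1)] by blast
      have k0: "k > 0" using k(1) by simp
      note rank = dickson_rank_dvd_iff[OF t3 p(1) k0 p(2)]
      have "dickson_rank t p \<le> k" using rank(2)[of k] p(2) k0 by (intro dvd_imp_le) auto
      moreover have "\<not> dickson_rank t p < k"
        using p(3)[of "dickson_rank t p"] rank(1) rank(2)[of "dickson_rank t p"] by auto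
      ultimately have rk: "dickson_rank t p = k" by simp
      have "primitive_prime_divisor L n p"
        unfolding primitive_prime_divisor_def
      proof (intro conjI allI impI)
        show "int p dvd L n" using pn p(1,2) by blast
        fix m assume "1 \<le> m \<and> m < n \<and> L m \<noteq> 0"
        then have m: "1 \<le> m" "m < n" by auto
        show "\<not> int p dvd L m"
        proof
          assume dvd: "int p dvd L m"
          show False
          proof (cases "even m")
            case True
            then obtain l where l: "m = 2 * l" by (elim evenE)
            have "L m = - (dickson t l - 2)" unfolding l using even[of l] m l by simp
            then have "int p dvd dickson t l - 2" using dvd by (metis dvd_minus_iff)
            moreover have "1 \<le> l" "l < k" using m k(2) l by auto
            ultimately show False using p(3) by blast
          next
            case False
            then have "k dvd m" using dvd_dickson[OF _ dvd] rank(2) rk by blast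
            then show False using odd_dvd[of m] False m by simp
          qed
        qed
      qed (fact p(1))
      then show ?thesis by blast
    qed
    show ?thesis
    proof (cases "even n")
      case False
      have "\<exists>p. primitive_prime_divisor L n p"
      proof (rule primitiveI[of n])
        show "int p dvd L n" if "prime p" "int p dvd dickson t n - 2" for p
        proof -
          have "int p dvd (L n)\<^sup>2" using odd[OF False] that(2) by simp
          moreover have "prime (int p)" using that(1) by simp
          ultimately show ?thesis using prime_dvd_power by blast
        qed
        show "n \<le> m" if "odd m" "n dvd m" for m
          using that by (intro dvd_imp_le) (auto simp: odd_pos)
      qed (use n in auto)
      moreover have "\<not> [n = 2] (mod 4)" using False unfolding cong_def by presburger
      ultimately show ?thesis by blast
    next
      case True
      then obtain k where k: "n = 2 * k" by (elim evenE)
      have Ln: "L n = - (dickson t k - 2)" using even[of k] n by (simp add: k)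
      show ?thesis
      proof (cases "even k")
        case True
        have "\<exists>p. primitive_prime_divisor L n p"
        proof (rule primitiveI[of k])
          show "int p dvd L n" if "int p dvd dickson t k - 2" for p
            unfolding Ln using that by (simp only: dvd_minus_iff)
          \<comment> \<open>Vacuous: an even \<open>k\<close> has no odd multiples.\<close>
          show "n \<le> m" if "odd m" "k dvd m" for m
            using that True by (metis dvd_trans)
        qed (use n k in auto)
        moreover have "\<not> [n = 2] (mod 4)" using True k unfolding cong_def by presburger
        ultimately show ?thesis by blast
      next
        case False
        \<comment> \<open>Every prime dividing \<open>L n\<close> already divides the nonzero
          earlier term \<open>L k\<close>.\<close>
        have "L n = - (L k * L k)" using odd[OF False] Ln by (simp add: power2_eq_square)
        moreover have "dickson t k - 2 \<noteq> 0" using dickson_ge_3[OF t3, of k] n k by simp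
        then have "L k \<noteq> 0" using odd[OF False] by auto
        moreover have "1 \<le> k" "k < n" using n k by auto
        ultimately have "\<not> primitive_prime_divisor L n p" for p
          unfolding primitive_prime_divisor_def
          by (metis dvd_minus_iff of_nat_dvd_iff prime_dvd_multD prime_nat_int_transfer)
        moreover have "[n = 2] (mod 4)" using False k unfolding cong_def by presburger
        ultimately show ?thesis by blast
      qed
    qed
  qed
  show ?thesis using norm_1 norm_minus_1 unfolding L_def by blast
qed

end
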